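(* For every integer $n \geq 4$, the $n$-dimensional split-star network $S_n^2$ is 2-DCC vertex $[3, n!/2]$-pancyclic. That is, for any two distinct vertices $u, v$ of $S_n^2$ and any integer $\ell$ with $3 \leq \ell \leq n!/2$, there exist two vertex-disjoint cycles $C_1, C_2$ in $S_n^2$ such that either ($u \in V(C_1)$, $|C_1| = \ell$, $v \in V(C_2)$, $|C_2| = n! - \ell$) or ($u \in V(C_1)$, $|C_1| = n! - \ell$, $v \in V(C_2)$, $|C_2| = \ell$).
   Context: For $n \geq 3$, the split-star network $S_n^2$ is the graph whose vertex set is the set of all permutations of $[n]=\{1,\dots,n\}$, written as strings $x_1x_2\cdots x_n$. Two distinct vertices $u = x_1\cdots x_n$ and $v = y_1\cdots y_n$ are adjacent iff one of the following holds: (i) $y_1 = x_2$, $y_2 = x_1$, $y_j = x_j$ for all $j \in [3,n]$; (ii) for some $i \in [3,n]$: $y_1 = x_2$, $y_2 = x_i$, $y_i = x_1$, and $y_j = x_j$ for all $j \in [3,n]\setminus\{i\}$; (iii) for some $i \in [3,n]$: $y_1 = x_i$, $y_2 = x_1$, $y_i = x_2$, and $y_j = x_j$ for all $j \in [3,n]\setminus\{i\}$. The length of a cycle is its number of edges (equal to its number of vertices). For positive integers $r_1 \le r_2$, a graph $G$ is 2-DCC vertex $[r_1,r_2]$-pancyclic if for every integer $\ell \in [r_1,r_2]$ and any two distinct vertices $u,v$, there exist two vertex-disjoint cycles $C_1, C_2$ with $u\in V(C_1)$, $v\in V(C_2)$, and $\{|C_1|,|C_2|\} $ equal to $(\ell,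 |V(G)|-\ell)$ in one of the two orders (so $V(C_1)\cup V(C_2)=V(G)$). *)

theory Defs
  imports "Graph_Theory.Graph_Theory" "HOL-Combinatorics.Permutations"
begin

(* An undirected simple graph is a symmetric loop-free digraph without parallel arcs (pair_graph),
   each edge being represented by its two arcs. *)

(* The string x_1 x_2 ... x_n is the function x with x i = x_i for i in {1..n} (and x i = i
   outside, by definition of permutes). *)
definition split_star_adj :: "nat \<Rightarrow> (nat \<Rightarrow> nat) \<Rightarrow> (nat \<Rightarrow> nat) \<Rightarrow> bool" where
  "split_star_adj n x y \<longleftrightarrow>
     (y 1 = x 2 \<and> y 2 = x 1 \<and> (\<forall>j\<in>{3..n}. y j = x j)) \<or>
     (\<exists>i\<in>{3..n}. y 1 = x 2 \<and> y 2 = x i \<and> y i = x 1 \<and> (\<forall>j\<in>{3..n} - {i}. y j = x j)) \<or>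
     (\<exists>i\<in>{3..n}. y 1 = x i \<and> y 2 = x 1 \<and> y i = x 2 \<and> (\<forall>j\<in>{3..n} - {i}. y j = x j))"

definition split_star :: "nat \<Rightarrow> (nat \<Rightarrow> nat) pair_pre_digraph" where
  "split_star n =
     \<lparr> pverts = {x. x permutes {1..n}},
       parcs = {(x, y). x permutes {1..n} \<and> y permutes {1..n} \<and> x \<noteq> y \<and> split_star_adj n x y} \<rparr>"

lemma card_pverts_split_star: "card (pverts (split_star n)) = fact n"
  by (simp add: split_star_def card_permutations)

lemma split_star_adj_sym: "split_star_adj n x y \<Longrightarrow> split_star_adj n y x"
  unfolding split_star_adj_def by (elim disjE bexE conjE) (simp, metis, metis)

lemma pair_graph_split_star: "pair_graph (split_star n)"
proof
  show "finite (pverts (split_star n))"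
    by (simp add: split_star_def finite_permutations)
  have "parcs (split_star n) \<subseteq> pverts (split_star n) \<times> pverts (split_star n)"
    by (auto simp: split_star_def)
  then show "finite (parcs (split_star n))"
    using \<open>finite (pverts (split_star n))\<close> finite_subset by blast
  show "symmetric (with_proj (split_star n))"
    by (auto simp: symmetric_def split_star_def sym_def intro: split_star_adj_sym)
qed (auto simp: split_star_def)

(* The library notion of cycle, applied to a pair_graph, also admits the closed walk u, v, u along
   the two arcs of a single edge; the length condition rules it out. *)
definition graph_cycle :: "'a pair_pre_digraph \<Rightarrow> ('a \<times> 'a) awalk \<Rightarrow> bool" where
  "graph_cycle G C \<longleftrightarrow> pre_digraph.cycle (with_proj G) C \<and> 3 \<le> length C"

(* On a closed walk every vertex is the tail of one of the arcs. *)
definition cycle_verts :: "('a \<times> 'a) awalk \<Rightarrow> 'a set" where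
  "cycle_verts C = fst ` set C"

definition two_dcc_vertex_pancyclic :: "'a pair_pre_digraph \<Rightarrow> nat \<Rightarrow> nat \<Rightarrow> bool" where
  "two_dcc_vertex_pancyclic G r1 r2 \<longleftrightarrow>
     (\<forall>l\<in>{r1..r2}. \<forall>u\<in>pverts G. \<forall>v\<in>pverts G. u \<noteq> v \<longrightarrow>
        (\<exists>C1 C2. graph_cycle G C1 \<and> graph_cycle G C2 \<and>
           cycle_verts C1 \<inter> cycle_verts C2 = {} \<and>
           u \<in> cycle_verts C1 \<and> v \<in> cycle_verts C2 \<and>
           (length C1 = l \<and> length C2 = card (pverts G) - l \<or>
            length C1 = card (pverts G) - l \<and> length C2 = l)))"

end

theory Submission
  imports Defs
begin

text \<open>
  Left multiplication by a permutation is an automorphism of the split-star network. Hence a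
  spanning pair of disjoint cycles of lengths l and n! - l that separates u from v exists as soon as
  there is one whose first vertex set C is not closed under right multiplication by g = inv u o v:
  if x is in C and x o g is not, translate by u o inv x. So for every l and every g other than the
  identity a single suitable partition is enough, and the positions of u and v play no role.

  Such partitions are built by induction on n. Fixing the last symbol splits the network of
  dimension n = m + 1 into n copies of the network of dimension m, every vertex having two
  neighbours outside its copy, in the copies named by its first two symbols. As the copies are
  Hamiltonian-connected, a path whose end vertices have neighbours in two different copies can be
  closed up through any set of whole copies containing these two. For l = q m! + r, split the copy
  fixing n into a piece of r vertices and the rest, and close the two parts up through q and
  n - 1 - q whole copies. This fails for r = 0, where the resulting set could be closed under right
  multiplication by the transposition (1 2), and for l = m! + 1, where a single vertex would have to
  be attached to a single copy. There one or two vertices of the copy fixing n are traded for an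
  edge of another copy. The case n = 4 is a computation with explicit cycles.
\<close>

section \<open>Hamiltonian paths and cycles\<close>

text \<open>The vertex \<open>x \<circ> g\<close> lies in the copy named by \<open>x (g n)\<close>,
  so the effect of g on n decides how a set is shown not to be closed. If g moves n, the symbols
  \<open>x n\<close> and \<open>x (g n)\<close> can be prescribed independently, and a set that
  contains one whole copy and misses another is never closed. If g fixes n, every union of whole
  copies is closed, so the copy fixing n must be cut by a set that is not closed under g, now seen
  as a permutation of the smaller range. Hence \<open>splittable\<close> speaks of every nontrivial
  h. It admits parts of one or two vertices, which are no cycles, because r is a remainder modulo m!
  and takes every value. The edges between copies do not form a matching: vertices of two copies may
  share a neighbour in a third. Each closing step therefore has to show that its two arrival
  vertices differ: they lie in different copies, or the departing vertices lie in the same copy, or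
  the first two symbols of one departing vertex do not name the copy of the other. Along an edge of
  type (i) the first two symbols stay the same, so its ends reach only two copies; all other edges
  reach three.\<close>

inductive ham_path :: "('a \<Rightarrow> 'a \<Rightarrow> bool) \<Rightarrow> 'a set \<Rightarrow> 'a \<Rightarrow> 'a \<Rightarrow> bool" for R where
  single: "ham_path R {a} a a"
| step: "ham_path R (insert a S) a c" if "ham_path R S b c" "R a b" "a \<notin> S"

text \<open>For a symmetric relation the bound on the cardinality excludes a single edge run in both
  directions.\<close>

definition ham_cycle :: "('a \<Rightarrow> 'a \<Rightarrow> bool) \<Rightarrow> 'a set \<Rightarrow> bool" where
  "ham_cycle R S \<longleftrightarrow> 3 \<le> card S \<and> (\<exists>a b. ham_path R S a b \<and> R b a)"

lemma ham_path_ends: "ham_path R S a b \<Longrightarrow> a \<in> S \<and> b \<in> S \<and> finite S"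
  by (induction rule: ham_path.induct) auto

lemma ham_path_join:
  assumes "ham_path R S a b" "ham_path R T c d" "R b c" "S \<inter> T = {}"
  shows "ham_path R (S \<union> T) a d"
  using assms
proof (induction rule: ham_path.induct)
  case (single a)
  then show ?case using ham_path.step[of R T c d a] by auto
next
  case (step S b c' a)
  then have "ham_path R (S \<union> T) b d" "a \<notin> S \<union> T" by auto
  then show ?case using ham_path.step[of R "S \<union> T" b d a] step.hyps by simp
qed

lemma ham_path_cons:
  "ham_path R T c d \<Longrightarrow> R a c \<Longrightarrow> a \<notin> T \<Longrightarrow> ham_path R (insert a T) a d"
  by (rule ham_path.step)

lemma ham_path_snoc:
  "ham_path R S a b \<Longrightarrow> R b c \<Longrightarrow> c \<notin> S \<Longrightarrow> ham_path R (insert c S) a c"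
  using ham_path_join[OF _ ham_path.single, of R S a b c] by auto

lemma ham_path_rev:
  assumes "symp R" "ham_path R S a b"
  shows "ham_path R S b a"
  using assms(2)
proof (induction rule: ham_path.induct)
  case (step S b c a)
  then show ?case using ham_path_snoc[OF step.IH] sympD[OF assms(1)] by blast
qed (rule ham_path.single)

lemma ham_path_mono:
  assumes "ham_path R S a b" "\<And>x y. x \<in> S \<Longrightarrow> y \<in> S \<Longrightarrow> R x y \<Longrightarrow> R' x y"
  shows "ham_path R' S a b"
  using assms
proof (induction rule: ham_path.induct)
  case (step S b c a)
  then have "ham_path R' S b c" "R' a b" using ham_path_ends[OF step.hyps(1)] by auto
  then show ?case using step.hyps by (blast intro: ham_path.step)
qed (rule ham_path.single)

lemma ham_path_image:
  assumes "ham_path R S a b" "\<And>x y. x \<in> S \<Longrightarrow> y \<in> S \<Longrightarrow> R x y \<Longrightarrow> R' (f x) (f y)" "inj_on f S"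
  shows "ham_path R' (f ` S) (f a) (f b)"
  using assms
proof (induction rule: ham_path.induct)
  case (single a)
  then show ?case by (simp add: ham_path.single)
next
  case (step S b c a)
  then have "ham_path R' (f ` S) (f b) (f c)" by (simp add: inj_on_insert)
  moreover have "R' (f a) (f b)" using step ham_path_ends[OF step.hyps(1)] by auto
  moreover have "f a \<notin> f ` S" using step by (simp add: inj_on_insert)
  ultimately show ?case using ham_path.step[of R' "f ` S"] by simp
qed

lemma ham_path_uncons:
  assumes "ham_path R S a b" "a \<noteq> b"
  obtains c where "ham_path R (S - {a}) c b" "R a c"
  using assms by (cases rule: ham_path.cases) auto

lemma ham_path_eq_ends: "ham_path R S a a \<Longrightarrow> S = {a}"
  by (erule ham_path.cases) (auto dest: ham_path_ends)

lemma ham_path_split: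
  assumes "ham_path R S a b" "x \<in> S" "x \<noteq> a"
  obtains S1 S2 c where "S = S1 \<union> S2" "S1 \<inter> S2 = {}" "ham_path R S1 a c" "R c x" "ham_path R S2 x b"
  using assms
proof (induction arbitrary: thesis rule: ham_path.induct)
  case (step S b c a)
  show ?case
  proof (cases "x = b")
    case True
    show ?thesis
      by (rule step.prems(1)[of "{a}" S a]) (use step True ham_path.single in auto)
  next
    case False
    then obtain S1 S2 d where *: "S = S1 \<union> S2" "S1 \<inter> S2 = {}" "ham_path R S1 b d" "R d x" "ham_path R S2 x c"
      using step by blast
    show ?thesis
      by (rule step.prems(1)[of "insert a S1" S2 d]) (use * step ham_path.step[OF *(3)] in auto)
  qed
qed auto

text \<open>Cutting just before \<open>x\<close> and rejoining the two parts across the closing edge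
  rotates the cycle so that it starts at \<open>x\<close>.\<close>

lemma ham_cycle_arc:
  assumes "ham_cycle R S" "x \<in> S"
  obtains c where "ham_path R S x c" "R c x"
proof -
  obtain a b where ab: "ham_path R S a b" "R b a" using assms by (auto simp: ham_cycle_def)
  show ?thesis
  proof (cases "x = a")
    case False
    obtain S1 S2 c where *: "S = S1 \<union> S2" "S1 \<inter> S2 = {}" "ham_path R S1 a c" "R c x" "ham_path R S2 x b"
      by (rule ham_path_split[OF ab(1) assms(2) False])
    show ?thesis
      by (rule that[OF _ *(4)]) (use ham_path_join[OF *(5,3) ab(2)] * in \<open>auto simp: Un_commute\<close>)
  qed (use that ab in auto)
qed

text \<open>The two paths arise by removing either cycle edge at \<open>x\<close>. Having both
  allows one neighbour to be rejected, as \<open>hc_arc\<close> does with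
  \<open>swap12 x\<close>.\<close>

lemma ham_cycle_two_arcs:
  assumes "symp R" "ham_cycle R S" "x \<in> S"
  obtains c d where "c \<noteq> d" "ham_path R S x c" "R x c" "ham_path R S x d" "R x d"
proof -
  obtain c where c: "ham_path R S x c" "R c x" using ham_cycle_arc[OF assms(2,3)] .
  have card: "3 \<le> card S" using assms(2) by (simp add: ham_cycle_def)
  have "x \<noteq> c" using ham_path_eq_ends[of R S x] c card by auto
  then obtain d where d: "ham_path R (S - {x}) d c" "R x d" using ham_path_uncons[OF c(1)] by blast
  have "d \<noteq> c"
  proof
    assume "d = c"
    then have "S - {x} = {c}" using d ham_path_eq_ends[of R "S - {x}" c] by simp
    then have "S = {x, c}" using assms(3) by auto
    then show False using card \<open>x \<noteq> c\<close> by simp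
  qed
  moreover have "ham_path R S d x" using ham_path_snoc[OF d(1) c(2)] assms(3) by (simp add: insert_absorb)
  ultimately show ?thesis using that[of c d] c d ham_path_rev[OF assms(1)] sympD[OF assms(1)] by blast
qed

lemma ham_cycle_mono:
  assumes "ham_cycle R S" "\<And>x y. x \<in> S \<Longrightarrow> y \<in> S \<Longrightarrow> R x y \<Longrightarrow> R' x y"
  shows "ham_cycle R' S"
  using assms ham_path_mono[of R S _ _ R'] ham_path_ends[of R S] unfolding ham_cycle_def by blast

lemma ham_cycle_image:
  assumes "ham_cycle R S" "\<And>x y. x \<in> S \<Longrightarrow> y \<in> S \<Longrightarrow> R x y \<Longrightarrow> R' (f x) (f y)" "inj_on f S"
  shows "ham_cycle R' (f ` S)"
  using assms ham_path_image[of R S _ _ R' f] ham_path_ends[of R S] unfolding ham_cycle_def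
  by (metis card_image)

text \<open>Paths are kept as relations between a vertex set and two ends, so that joining and
  translating become identities of sets. Lists serve only for the library cycles and for computed
  walks.\<close>

lemma ham_path_iff_list:
  "ham_path R S a b \<longleftrightarrow> (\<exists>p. p \<noteq> [] \<and> distinct p \<and> set p = S \<and> successively R p \<and> hd p = a \<and> last p = b)"
  (is "_ \<longleftrightarrow> ?r S a b")
proof
  show "ham_path R S a b \<Longrightarrow> ?r S a b"
  proof (induction rule: ham_path.induct)
    case (single a)
    show ?case by (rule exI[of _ "[a]"]) simp
  next
    case (step S b c a)
    then obtain p where "p \<noteq> [] \<and> distinct p \<and> set p = S \<and> successively R p \<and> hd p = b \<and> last p = c" by blast
    then show ?case using step by (intro exI[of _ "a # p"]) (auto simp: successively_Cons)
  qed
next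
  have "p \<noteq> [] \<Longrightarrow> distinct p \<Longrightarrow> successively R p \<Longrightarrow> ham_path R (set p) (hd p) (last p)" for p
  proof (induction p)
    case (Cons x p)
    then show ?case
      by (cases "p = []") (auto simp: successively_Cons intro: ham_path.intros)
  qed simp
  then show "?r S a b \<Longrightarrow> ham_path R S a b" by blast
qed

lemma graph_cycle_of_ham_cycle:
  assumes hc: "ham_cycle R S" and R: "\<And>x y. x \<in> S \<Longrightarrow> y \<in> S \<Longrightarrow> R x y \<Longrightarrow> (x, y) \<in> parcs G" and S: "S \<subseteq> pverts G"
  shows "\<exists>C. graph_cycle G C \<and> cycle_verts C = S \<and> length C = card S"
proof -
  obtain a b where ab: "ham_path R S a b" "R b a" and card: "3 \<le> card S"
    using hc by (auto simp: ham_cycle_def)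
  obtain p where p: "p \<noteq> []" "distinct p" "set p = S" "successively R p" "hd p = a" "last p = b"
    using ab by (auto simp: ham_path_iff_list)
  \<comment> \<open>\<open>q\<close> lists the tails, and the last arc leads to \<open>z\<close>.
    The return vertex stays fixed while the list shrinks from the front; taking \<open>z = a\<close>
    closes the cycle.\<close>
  have gen: "\<exists>C. set C \<subseteq> parcs G \<and> pcas (hd q) C z \<and> map fst C = q \<and> pawalk_verts (hd q) C = q @ [z]"
    if "q \<noteq> []" "set q \<subseteq> S" "successively R q" "(last q, z) \<in> parcs G" for q z
    using that
  proof (induction q)
    case (Cons x q)
    show ?case
    proof (cases "q = []")
      case True
      then show ?thesis using Cons by (intro exI[of _ "[(x, z)]"]) auto
    next
      case False
      then obtain C where C: "set C \<subseteq> parcs G" "pcas (hd q) C z" "map fst C = q" "pawalk_verts (hd q) C = q @ [z]"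
        using Cons by (auto simp: successively_Cons)
      have "hd q \<in> S" using Cons.prems(2) hd_in_set[OF False] by auto
      then have "(x, hd q) \<in> parcs G" using Cons.prems False R[of x "hd q"] by (auto simp: successively_Cons)
      then show ?thesis using C by (intro exI[of _ "(x, hd q) # C"]) auto
    qed
  qed simp
  obtain C where C: "set C \<subseteq> parcs G" "pcas a C a" "map fst C = p" "pawalk_verts a C = p @ [a]"
    using gen[of p a] p ab R ham_path_ends[OF ab(1)] by auto
  have "pre_digraph.awalk (with_proj G) a C a"
    unfolding pre_digraph.awalk_def cas_with_proj_eq using C S ham_path_ends[OF ab(1)] by auto
  moreover have "distinct (tl (pre_digraph.awalk_verts (with_proj G) a C))"
    unfolding awalk_verts_with_proj_eq using C p by (cases p) auto
  moreover have len: "length C = card S" using C p distinct_card length_map by metis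
  ultimately have "graph_cycle G C" using card by (auto simp: graph_cycle_def pre_digraph.cycle_def)
  moreover have "cycle_verts C = S" using C p by (metis cycle_verts_def set_map)
  ultimately show ?thesis using len by blast
qed

section \<open>The split-star network\<close>

definition perms :: "nat \<Rightarrow> (nat \<Rightarrow> nat) set" where
  "perms n = {x. x permutes {1..n}}"

definition adj :: "nat \<Rightarrow> (nat \<Rightarrow> nat) \<Rightarrow> (nat \<Rightarrow> nat) \<Rightarrow> bool" where
  "adj n x y \<longleftrightarrow> x \<in> perms n \<and> y \<in> perms n \<and> split_star_adj n x y"

text \<open>In dimension n these are the names of the copies that contain the outside neighbours of
  \<open>x\<close>. Their order is irrelevant for that.\<close>

definition pair :: "(nat \<Rightarrow> nat) \<Rightarrow> nat set" where
  "pair x = {x 1, x 2}"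

definition swap12 :: "(nat \<Rightarrow> nat) \<Rightarrow> nat \<Rightarrow> nat" where
  "swap12 x = x(1 := x 2, 2 := x 1)"

definition copies :: "nat \<Rightarrow> nat set \<Rightarrow> (nat \<Rightarrow> nat) set" where
  "copies n X = {x \<in> perms n. x n \<in> X}"

(* The neighbour of x, in the copy fixing the symbol a in position n, along an edge of type (ii)
   or (iii) with i = n; meaningful when a is one of the first two symbols of x. *)
definition cross :: "nat \<Rightarrow> (nat \<Rightarrow> nat) \<Rightarrow> nat \<Rightarrow> nat \<Rightarrow> nat" where
  "cross n x a = (if x 1 = a then x(1 := x 2, 2 := x n, n := x 1) else x(1 := x n, 2 := x 1, n := x 2))"

abbreviation hp where "hp n \<equiv> ham_path (adj n)"
abbreviation hc where "hc n \<equiv> ham_cycle (adj n)"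

lemmas hp_join = ham_path_join[where R = "adj n"] for n
lemmas hp_cons = ham_path_cons[where R = "adj n"] for n
lemmas hp_snoc = ham_path_snoc[where R = "adj n"] for n

lemma perms_eq_iff: "x \<in> perms n \<Longrightarrow> x i = x j \<longleftrightarrow> i = j"
  unfolding perms_def using permutes_inj by (metis injD mem_Collect_eq)

lemma perms_range: "x \<in> perms n \<Longrightarrow> x i \<in> {1..n} \<longleftrightarrow> i \<in> {1..n}"
  unfolding perms_def using permutes_in_image by fastforce

lemma perms_outside: "x \<in> perms n \<Longrightarrow> i \<notin> {1..n} \<Longrightarrow> x i = i"
  unfolding perms_def using permutes_not_in by fastforce

lemma perms_comp: "x \<in> perms n \<Longrightarrow> y \<in> perms n \<Longrightarrow> x \<circ> y \<in> perms n"
  unfolding perms_def using permutes_compose by fastforce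

lemma perms_inv: "x \<in> perms n \<Longrightarrow> inv x \<in> perms n"
  unfolding perms_def using permutes_inv by fastforce

lemma perms_inv_comp: "x \<in> perms n \<Longrightarrow> x \<circ> inv x = id" "x \<in> perms n \<Longrightarrow> inv x \<circ> x = id"
  unfolding perms_def using permutes_inv_o by blast+

lemma inj_on_left: "q \<in> perms n \<Longrightarrow> inj_on ((\<circ>) q) S"
  by (metis (no_types, lifting) comp_assoc comp_id fun.map_id inj_onI perms_inv_comp(2))

lemma id_in_perms: "id \<in> perms n"
  by (simp add: perms_def permutes_id)

lemma perms_transpose: "i \<in> {1..n} \<Longrightarrow> j \<in> {1..n} \<Longrightarrow> transpose i j \<in> perms n"
  by (simp add: perms_def permutes_swap_id)

lemma finite_perms: "finite (perms n)"
  by (simp add: perms_def finite_permutations)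

lemma card_perms: "card (perms n) = fact n"
  by (simp add: perms_def card_permutations)

lemma perms_Suc_subset: "perms n \<subseteq> perms (Suc n)"
  unfolding perms_def using permutes_subset[of _ "{1..n}" "{1..Suc n}"] by fastforce

lemma pair_subset: "x \<in> perms n \<Longrightarrow> 2 \<le> n \<Longrightarrow> pair x \<subseteq> {1..n}"
  using perms_range[of x n 1] perms_range[of x n 2] by (auto simp: pair_def)

lemma nth_notin_pair: "x \<in> perms n \<Longrightarrow> 3 \<le> k \<Longrightarrow> x k \<notin> pair x"
  using perms_eq_iff[of x n] by (auto simp: pair_def)

lemma card_pair: "x \<in> perms n \<Longrightarrow> card (pair x) = 2"
  using perms_eq_iff[of x n 1 2] by (simp add: pair_def)

section \<open>Adjacency and its invariance under relabelling and under raising the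
  dimension\<close>

lemma symp_adj: "symp (adj n)"
  unfolding symp_def adj_def using split_star_adj_sym by blast

lemmas adj_sym = sympD[OF symp_adj]

text \<open>Adjacency only says which entry of one string equals which entry of the other; applying
  \<open>q\<close> to all entries preserves such equations.\<close>

lemma split_star_adj_left: "split_star_adj n x y \<Longrightarrow> split_star_adj n (q \<circ> x) (q \<circ> y)"
  unfolding split_star_adj_def comp_apply by (elim disjE bexE conjE) (metis+)

lemma adj_left: "q \<in> perms n \<Longrightarrow> adj n x y \<Longrightarrow> adj n (q \<circ> x) (q \<circ> y)"
  unfolding adj_def by (simp add: perms_comp split_star_adj_left)

lemma adj_Suc:
  assumes "adj n x y"
  shows "adj (Suc n) x y"
proof -
  have "x (Suc n) = y (Suc n)" using assms by (auto simp: adj_def perms_outside)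
  \<comment> \<open>\<open>A\<close> is empty for an edge of type (i) and \<open>{i}\<close> for
    types (ii) and (iii).\<close>
  then have *: "\<forall>j\<in>{3..Suc n} - A. y j = x j" if "\<forall>j\<in>{3..n} - A. y j = x j" for A
    using that by (auto simp: le_Suc_eq)
  have "split_star_adj n x y" using assms by (simp add: adj_def)
  then have "split_star_adj (Suc n) x y"
    unfolding split_star_adj_def
  proof (elim disjE bexE conjE)
    assume "y 1 = x 2" "y 2 = x 1" "\<forall>j\<in>{3..n}. y j = x j"
    moreover from this(3) have "\<forall>j\<in>{3..Suc n}. y j = x j" using *[of "{}"] by blast
    ultimately show "(y 1 = x 2 \<and> y 2 = x 1 \<and> (\<forall>j\<in>{3..Suc n}. y j = x j)) \<or>
      (\<exists>i\<in>{3..Suc n}. y 1 = x 2 \<and> y 2 = x i \<and> y i = x 1 \<and> (\<forall>j\<in>{3..Suc n} - {i}. y j = x j)) \<or>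
      (\<exists>i\<in>{3..Suc n}. y 1 = x i \<and> y 2 = x 1 \<and> y i = x 2 \<and> (\<forall>j\<in>{3..Suc n} - {i}. y j = x j))"
      by blast
  next
    fix i assume "i \<in> {3..n}" "y 1 = x 2" "y 2 = x i" "y i = x 1" "\<forall>j\<in>{3..n} - {i}. y j = x j"
    moreover from this(1,5) have "i \<in> {3..Suc n}" "\<forall>j\<in>{3..Suc n} - {i}. y j = x j"
      using *[of "{i}"] by (auto simp only: atLeastAtMost_iff)
    ultimately show "(y 1 = x 2 \<and> y 2 = x 1 \<and> (\<forall>j\<in>{3..Suc n}. y j = x j)) \<or>
      (\<exists>i\<in>{3..Suc n}. y 1 = x 2 \<and> y 2 = x i \<and> y i = x 1 \<and> (\<forall>j\<in>{3..Suc n} - {i}. y j = x j)) \<or>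
      (\<exists>i\<in>{3..Suc n}. y 1 = x i \<and> y 2 = x 1 \<and> y i = x 2 \<and> (\<forall>j\<in>{3..Suc n} - {i}. y j = x j))"
      by blast
  next
    fix i assume "i \<in> {3..n}" "y 1 = x i" "y 2 = x 1" "y i = x 2" "\<forall>j\<in>{3..n} - {i}. y j = x j"
    moreover from this(1,5) have "i \<in> {3..Suc n}" "\<forall>j\<in>{3..Suc n} - {i}. y j = x j"
      using *[of "{i}"] by (auto simp only: atLeastAtMost_iff)
    ultimately show "(y 1 = x 2 \<and> y 2 = x 1 \<and> (\<forall>j\<in>{3..Suc n}. y j = x j)) \<or>
      (\<exists>i\<in>{3..Suc n}. y 1 = x 2 \<and> y 2 = x i \<and> y i = x 1 \<and> (\<forall>j\<in>{3..Suc n} - {i}. y j = x j)) \<or>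
      (\<exists>i\<in>{3..Suc n}. y 1 = x i \<and> y 2 = x 1 \<and> y i = x 2 \<and> (\<forall>j\<in>{3..Suc n} - {i}. y j = x j))"
      by blast
  qed
  then show ?thesis using assms perms_Suc_subset unfolding adj_def by blast
qed

section \<open>The edge exchanging the first two symbols\<close>

lemma swap12_comp: "swap12 x = x \<circ> transpose 1 2"
  by (rule ext) (simp add: swap12_def transpose_def)

lemma swap12_in_perms: "x \<in> perms n \<Longrightarrow> 2 \<le> n \<Longrightarrow> swap12 x \<in> perms n"
  by (simp add: swap12_comp perms_comp perms_transpose)

lemma adj_swap12: "x \<in> perms n \<Longrightarrow> 2 \<le> n \<Longrightarrow> adj n x (swap12 x)"
  by (simp add: adj_def swap12_in_perms split_star_adj_def) (simp add: swap12_def)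

lemma pair_swap12: "pair (swap12 x) = pair x"
  by (auto simp: pair_def swap12_def)

lemma swap12_neq: "x \<in> perms n \<Longrightarrow> swap12 x \<noteq> x"
  using perms_eq_iff[of x n 1 2] by (auto simp: swap12_def fun_eq_iff)

text \<open>Edges of types (ii) and (iii) bring a symbol from a position at least 3 into the first
  two, which changes the pair.\<close>

lemma adj_pair_eq: 
  assumes "adj n x y" "pair x = pair y"
  shows "y = swap12 x"
proof -
  have x: "x \<in> perms n" and y: "y \<in> perms n" and s: "split_star_adj n x y"
    using assms by (auto simp: adj_def)
  have n: "x i \<notin> pair y" if "i \<in> {3..n}" for i
    using that nth_notin_pair[OF x] assms(2) by auto
  from s have *: "y 1 = x 2 \<and> y 2 = x 1 \<and> (\<forall>j\<in>{3..n}. y j = x j)"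
    unfolding split_star_adj_def by (elim disjE bexE conjE) (use n in \<open>fastforce simp: pair_def\<close>)+
  show ?thesis
  proof
    fix i
    consider "i = 1" | "i = 2" | "i \<in> {3..n}" | "i \<notin> {1..n}" "i \<noteq> 1" "i \<noteq> 2" by force
    then show "y i = swap12 x i"
      using * perms_outside[OF x] perms_outside[OF y] by cases (auto simp: swap12_def)
  qed
qed

lemma adj_pair_common: "adj n x y \<Longrightarrow> \<exists>a. a \<in> pair x \<and> a \<in> pair y"
  by (auto simp: adj_def split_star_adj_def pair_def)

section \<open>Edges between different copies\<close>

lemma cross_in_perms:
  assumes "x \<in> perms n" "3 \<le> n"
  shows "cross n x a \<in> perms n"
proof -
  have "cross n x a = x \<circ> (if x 1 = a then transpose 1 2 \<circ> transpose 2 n else transpose 1 2 \<circ> transpose 1 n)"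
    using assms(2) by (intro ext) (auto simp: cross_def transpose_def)
  then show ?thesis using assms by (auto intro!: perms_comp perms_transpose)
qed

lemma adj_cross:
  assumes "x \<in> perms n" "3 \<le> n"
  shows "adj n x (cross n x a)"
  using cross_in_perms[OF assms] assms unfolding adj_def split_star_adj_def
  by (auto simp: cross_def intro!: bexI[of _ n])

lemma cross_last: "a \<in> pair x \<Longrightarrow> 3 \<le> n \<Longrightarrow> cross n x a n = a"
  by (auto simp: cross_def pair_def)

lemma cross_in_copies:
  "x \<in> perms n \<Longrightarrow> 3 \<le> n \<Longrightarrow> a \<in> pair x \<Longrightarrow> a \<in> X \<Longrightarrow> cross n x a \<in> copies n X"
  by (simp add: copies_def cross_in_perms cross_last)

lemma pair_cross: 
  assumes "x \<in> perms n" "a \<in> pair x" "3 \<le> n"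
  shows "pair (cross n x a) = insert (x n) (pair x - {a})"
  using assms perms_eq_iff[OF assms(1), of 1 2] by (auto simp: cross_def pair_def)

(* The two vertices and their common neighbour form a triangle meeting three different copies. *)
lemma cross_collision:
  assumes x: "x \<in> perms n" and y: "y \<in> perms n" and n: "3 \<le> n" and "a \<in> pair x" "a \<in> pair y"
    and eq: "cross n x a = cross n y a" and neq: "x \<noteq> y"
  shows "x n \<noteq> y n" "x n \<in> pair y" "y n \<in> pair x"
proof -
  have pt: "cross n x a i = cross n y a i" for i using eq by simp
  \<comment> \<open>Along edges of one type the passage to the neighbour is injective, so a
    collision needs one edge of type (ii) and one of type (iii).\<close>
  have same: "x = y" if "(x 1 = a) = (y 1 = a)"
  proof
    fix i
    show "x i = y i"
      using that pt[of i] pt[of 1] pt[of 2] pt[of n] n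
      by (cases "x 1 = a") (auto simp: cross_def split: if_splits)
  qed
  have "(x 1 = a \<and> y 1 \<noteq> a) \<or> (x 1 \<noteq> a \<and> y 1 = a)" using same neq by blast
  then have "x n \<in> pair y \<and> y n \<in> pair x"
    using pt[of 1] pt[of 2] n by (auto simp: cross_def pair_def)
  then show "x n \<in> pair y" "y n \<in> pair x" "x n \<noteq> y n"
    using nth_notin_pair[OF x n] nth_notin_pair[OF y n] by auto
qed

text \<open>The two pairs always share a symbol, so if they differ they share exactly one.\<close>

lemma adj_pair_union:
  assumes "adj n x y" "pair x \<noteq> pair y"
  shows "card (pair x \<union> pair y) = 3"
proof -
  have x: "x \<in> perms n" and y: "y \<in> perms n" and s: "split_star_adj n x y"
    using assms by (auto simp: adj_def)
  obtain a where a: "a \<in> pair x" "a \<in> pair y" using adj_pair_common[OF assms(1)] by blast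
  obtain b where b: "pair x = {a, b}" "b \<noteq> a" using a card_pair[OF x] by (auto simp: card_2_iff doubleton_eq_iff)
  obtain c where c: "pair y = {a, c}" "c \<noteq> a" using a card_pair[OF y] by (auto simp: card_2_iff doubleton_eq_iff)
  have "pair x \<union> pair y = {a, b, c}" "b \<noteq> c" using b c assms(2) by auto
  then show ?thesis using b c by simp
qed

text \<open>The pairs are \<open>{c, b}\<close> and \<open>{c, d}\<close>. Any two of the three
  symbols can be divided between the two ends, and reversing the path settles which end gets
  which.\<close>

lemma arc_choice:
  assumes p: "hp n D x y" and adj: "adj n x y" "pair x \<noteq> pair y"
    and al: "a \<noteq> a'" "a \<in> pair x \<union> pair y" "a' \<in> pair x \<union> pair y"
  obtains u v where "hp n D u v" "adj n v u" "a \<in> pair u" "a' \<in> pair v" "{u, v} = {x, y}"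
proof -
  have x: "x \<in> perms n" and y: "y \<in> perms n" using adj by (auto simp: adj_def)
  obtain c where c: "c \<in> pair x" "c \<in> pair y" using adj_pair_common[OF adj(1)] by blast
  obtain b where b: "pair x = {c, b}" "b \<noteq> c" using c card_pair[OF x] by (auto simp: card_2_iff doubleton_eq_iff)
  obtain d where d: "pair y = {c, d}" "d \<noteq> c" using c card_pair[OF y] by (auto simp: card_2_iff doubleton_eq_iff)
  have "a \<in> pair x \<and> a' \<in> pair y \<or> a \<in> pair y \<and> a' \<in> pair x"
    using al b d by auto
  then show ?thesis
  proof
    assume "a \<in> pair x \<and> a' \<in> pair y" then show ?thesis
      using that[of x y] p adj_sym[OF adj(1)] by auto
  next
    assume "a \<in> pair y \<and> a' \<in> pair x" then show ?thesis
      using that[of y x] ham_path_rev[OF symp_adj p] adj(1) by auto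
  qed
qed

text \<open>At most one of the two cycle neighbours of \<open>x\<close> is \<open>swap12 x\<close>,
  the only neighbour with the same pair.\<close>

lemma hc_arc:
  assumes "hc n S" "x \<in> S"
  obtains y where "hp n S x y" "adj n x y" "pair x \<noteq> pair y"
  by (rule ham_cycle_two_arcs[OF symp_adj assms]) (metis adj_pair_eq)

section \<open>Permutations with prescribed values\<close>

lemma perm_exists1: "i \<in> {1..n} \<Longrightarrow> a \<in> {1..n} \<Longrightarrow> \<exists>x\<in>perms n. x i = a"
  by (rule bexI[of _ "transpose i a"]) (simp_all add: perms_transpose)

lemma perm_exists_step:
  assumes "x \<in> perms n" "i \<in> {1..n}" "a \<in> {1..n}"
  shows "\<exists>y\<in>perms n. y i = a \<and> (\<forall>j. j \<noteq> i \<longrightarrow> x j \<noteq> a \<longrightarrow> y j = x j)"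
proof -
  let ?t = "transpose (x i) a"
  have "x i \<in> {1..n}" using assms perms_range by blast
  then have "?t \<circ> x \<in> perms n" using perms_comp[OF perms_transpose assms(1)] assms(3) by blast
  moreover have "?t (x j) = x j" if "j \<noteq> i" "x j \<noteq> a" for j
    using perms_eq_iff[OF assms(1), of j i] that by (intro transpose_apply_other) simp_all
  ultimately show ?thesis by (intro bexI[of _ "?t \<circ> x"]) simp_all
qed

lemma perm_exists2:
  assumes "i \<in> {1..n}" "j \<in> {1..n}" "i \<noteq> j" "a \<in> {1..n}" "b \<in> {1..n}" "a \<noteq> b"
  shows "\<exists>x\<in>perms n. x i = a \<and> x j = b"
proof -
  obtain x where "x \<in> perms n" "x i = a" using perm_exists1 assms by blast
  moreover obtain y where y: "y \<in> perms n" "y j = b" "\<forall>k. k \<noteq> j \<longrightarrow> x k \<noteq> b \<longrightarrow> y k = x k"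
    using perm_exists_step[OF \<open>x \<in> perms n\<close> assms(2,5)] by blast
  ultimately have "y i = a" using y(3)[rule_format, of i] assms by simp
  then show ?thesis using y(1,2) by blast
qed

lemma perm_exists3:
  assumes "i \<in> {1..n}" "j \<in> {1..n}" "k \<in> {1..n}" "distinct [i, j, k]"
    "a \<in> {1..n}" "b \<in> {1..n}" "c \<in> {1..n}" "distinct [a, b, c]"
  shows "\<exists>x\<in>perms n. x i = a \<and> x j = b \<and> x k = c"
proof -
  obtain x where "x \<in> perms n" "x i = a" "x j = b" using perm_exists2[of i n j a b] assms by auto
  moreover obtain y where y: "y \<in> perms n" "y k = c" "\<forall>l. l \<noteq> k \<longrightarrow> x l \<noteq> c \<longrightarrow> y l = x l"
    using perm_exists_step[OF \<open>x \<in> perms n\<close> assms(3,7)] by blast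
  ultimately have "y i = a" "y j = b"
    using y(3)[rule_format, of i] y(3)[rule_format, of j] assms by simp_all
  then show ?thesis using y(1,2) by blast
qed

text \<open>The bound \<open>4 < n\<close> leaves three free positions whose values can be
  exchanged. Of three vertices at least one survives the exclusion of any two.\<close>

lemma perm_exists2_three:
  assumes "4 < n" "i \<in> {1..n}" "j \<in> {1..n}" "i \<noteq> j" "a \<in> {1..n}" "b \<in> {1..n}" "a \<noteq> b"
  shows "\<exists>x\<in>perms n. \<exists>y\<in>perms n. \<exists>z\<in>perms n. distinct [x, y, z] \<and> (\<forall>w\<in>{x, y, z}. w i = a \<and> w j = b)"
proof -
  obtain x where x: "x \<in> perms n" "x i = a" "x j = b" using perm_exists2[of i n j a b] assms by blast
  have "card ({1..n} - {i, j}) \<ge> 3" using assms by (simp add: card_Diff_subset)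
  then obtain T where T: "T \<subseteq> {1..n} - {i, j}" "card T = 3" by (rule obtain_subset_with_card_n)
  then obtain p q r where pqr: "T = {p, q, r}" "p \<noteq> q" "q \<noteq> r" "p \<noteq> r" by (meson card_3_iff)
  let ?y = "x \<circ> transpose p q" and ?z = "x \<circ> transpose p r"
  have t: "p \<in> {1..n}" "q \<in> {1..n}" "r \<in> {1..n}" "p \<notin> {i, j}" "q \<notin> {i, j}" "r \<notin> {i, j}" using pqr T by auto
  have "x p \<noteq> ?y p" "x p \<noteq> ?z p" "?y p \<noteq> ?z p"
    using pqr perms_eq_iff[OF x(1)] by auto
  then have "distinct [x, ?y, ?z]" by (metis distinct_length_2_or_more distinct_singleton)
  moreover have "\<forall>w\<in>{x, ?y, ?z}. w i = a \<and> w j = b" using x t by (auto simp: transpose_def)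
  moreover have "?y \<in> perms n" "?z \<in> perms n" using x t by (auto intro!: perms_comp perms_transpose)
  ultimately show ?thesis using x(1) by blast
qed

section \<open>Copies of the network of smaller dimension\<close>

lemma copies_subset: "copies n X \<subseteq> perms n"
  by (auto simp: copies_def)

lemma copies_Un: "copies n (X \<union> Y) = copies n X \<union> copies n Y"
  by (auto simp: copies_def)

lemma copies_disjoint: "X \<inter> Y = {} \<Longrightarrow> copies n X \<inter> copies n Y = {}"
  by (auto simp: copies_def)

lemma perms_last: "x \<in> perms n \<Longrightarrow> 1 \<le> n \<Longrightarrow> x n \<in> {1..n}"
  using perms_range[of x n n] by simp

lemma copies_all: "1 \<le> n \<Longrightarrow> copies n {1..n} = perms n"
  using perms_last unfolding copies_def by blast

lemma copies_last: "copies (Suc m) {Suc m} = perms m"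
proof
  show "copies (Suc m) {Suc m} \<subseteq> perms m"
  proof
    fix x assume "x \<in> copies (Suc m) {Suc m}"
    then have x: "x permutes {1..Suc m}" "x (Suc m) = Suc m" by (simp_all add: copies_def perms_def)
    have "x permutes {1..m}"
    proof (rule permutes_superset[OF x(1)])
      fix i assume "i \<in> {1..Suc m} - {1..m}"
      then have "i = Suc m" by auto
      then show "x i = i" using x(2) by simp
    qed
    then show "x \<in> perms m" by (simp add: perms_def)
  qed
  show "perms m \<subseteq> copies (Suc m) {Suc m}"
  proof
    fix x assume "x \<in> perms m"
    then show "x \<in> copies (Suc m) {Suc m}"
      using perms_Suc_subset perms_outside[of x m "Suc m"] by (auto simp: copies_def)
  qed
qed

text \<open>This carries facts about the copy fixing n over to every other copy.\<close>

lemma copies_left: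
  assumes "q \<in> perms n"
  shows "(\<circ>) q ` copies n X = copies n (q ` X)"
proof -
  have "y \<in> (\<circ>) q ` copies n X" if "y \<in> copies n (q ` X)" for y
  proof (rule image_eqI)
    show "y = q \<circ> (inv q \<circ> y)" using perms_inv_comp(1)[OF assms] by (simp add: o_assoc)
    obtain a where a: "a \<in> X" "y n = q a" using \<open>y \<in> _\<close> by (auto simp: copies_def)
    have "inv q (q a) = a" using perms_inv_comp(2)[OF assms] by (metis comp_apply id_apply)
    then show "inv q \<circ> y \<in> copies n X"
      using that a perms_comp[OF perms_inv[OF assms]] by (simp add: copies_def)
  qed
  then show ?thesis using perms_comp[OF assms] by (auto simp: copies_def)
qed

lemma card_copies:
  assumes "1 \<le> n" "X \<subseteq> {1..n}"
  shows "card (copies n X) = card X * fact (n - 1)"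
proof -
  have fin: "finite X" using assms(2) finite_subset by blast
  have one: "card (copies n {a}) = fact (n - 1)" if a: "a \<in> {1..n}" for a
  proof -
    obtain q where q: "q \<in> perms n" "q n = a" using perm_exists1[of n n a] assms a by auto
    have "copies n {a} = (\<circ>) q ` copies n {n}" using copies_left[OF q(1)] q(2) by simp
    then have "card (copies n {a}) = card (copies n {n})" by (simp only: card_image[OF inj_on_left[OF q(1)]])
    also have "copies n {n} = perms (n - 1)" using copies_last[of "n - 1"] assms by simp
    finally show ?thesis by (simp add: card_perms)
  qed
  have "copies n X = (\<Union>a\<in>X. copies n {a})" by (auto simp: copies_def)
  also have "card \<dots> = (\<Sum>a\<in>X. card (copies n {a}))"
  proof (rule card_UN_disjoint[OF fin])
    show "\<forall>i\<in>X. finite (copies n {i})" using finite_subset[OF copies_subset finite_perms] by blast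
    show "\<forall>i\<in>X. \<forall>j\<in>X. i \<noteq> j \<longrightarrow> copies n {i} \<inter> copies n {j} = {}" by (auto simp: copies_def)
  qed
  also have "\<dots> = card X * fact (n - 1)" using one assms(2) by (simp add: subset_iff)
  finally show ?thesis .
qed

lemma finite_copies: "finite (copies n X)"
  using finite_subset[OF copies_subset finite_perms] .

definition ham_connected :: "nat \<Rightarrow> bool" where
  "ham_connected n \<longleftrightarrow> (\<forall>x\<in>perms n. \<forall>y\<in>perms n. x \<noteq> y \<longrightarrow> hp n (perms n) x y)"

lemma hp_Suc: "hp m S x y \<Longrightarrow> hp (Suc m) S x y"
  using ham_path_mono adj_Suc by metis

lemma hc_Suc: "hc m S \<Longrightarrow> hc (Suc m) S"
  using ham_cycle_mono adj_Suc by metis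

lemma hp_left: "hp n S x y \<Longrightarrow> q \<in> perms n \<Longrightarrow> hp n ((\<circ>) q ` S) (q \<circ> x) (q \<circ> y)"
  by (erule ham_path_image) (blast intro: adj_left inj_on_left)+

lemma hc_left: "hc n S \<Longrightarrow> q \<in> perms n \<Longrightarrow> hc n ((\<circ>) q ` S)"
  by (erule ham_cycle_image) (blast intro: adj_left inj_on_left)+

section \<open>Paths and cycles through several copies\<close>

locale split_star_step =
  fixes n m :: nat
  assumes n: "n = Suc m" "4 \<le> m" and conn: "ham_connected m"
begin

lemma hp_copy:
  assumes "x \<in> copies n {a}" "y \<in> copies n {a}" "x \<noteq> y"
  shows "hp n (copies n {a}) x y"
proof -
  have a: "a \<in> {1..n}" using assms(1) n perms_last[of x n] by (auto simp: copies_def)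
  obtain q where q: "q \<in> perms n" "q n = a" using perm_exists1[of n n a] n a by auto
  have im: "copies n {a} = (\<circ>) q ` perms m" using copies_left[OF q(1)] q(2) copies_last[of m] n(1) by (metis image_empty image_insert)
  then obtain x' y' where *: "x' \<in> perms m" "y' \<in> perms m" "x = q \<circ> x'" "y = q \<circ> y'" using assms by auto
  then have "hp m (perms m) x' y'" using conn assms(3) by (auto simp: ham_connected_def)
  then show ?thesis using hp_left[OF hp_Suc] q(1) n(1) im * by simp
qed

text \<open>A passage from copy \<open>a\<close> to copy \<open>b\<close> must not start at the
  entry vertex \<open>x\<close> nor arrive at the final vertex \<open>y\<close>. Three candidates
  suffice: lying in one copy they have different neighbours in copy \<open>b\<close>, so
  \<open>x\<close> and \<open>y\<close> exclude at most one each.\<close>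

lemma bridge:
  assumes ab: "a \<in> {1..n}" "b \<in> {1..n}" "a \<noteq> b"
  obtains s where "s \<in> copies n {a}" "s \<noteq> x" "b \<in> pair s" "cross n s b \<noteq> y"
proof -
  have "\<exists>u\<in>perms n. \<exists>v\<in>perms n. \<exists>w\<in>perms n. distinct [u, v, w] \<and> (\<forall>z\<in>{u, v, w}. z n = a \<and> z 1 = b)"
    using perm_exists2_three[of n n 1 a b] ab n by auto
  then obtain u v w where *: "u \<in> perms n" "v \<in> perms n" "w \<in> perms n" "distinct [u, v, w]"
      "\<forall>z\<in>{u, v, w}. z n = a \<and> z 1 = b"
    by blast
  have "cross n s b \<noteq> cross n t b" if "s \<in> {u, v, w}" "t \<in> {u, v, w}" "s \<noteq> t" for s t
  proof
    assume eq: "cross n s b = cross n t b"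
    have st: "s \<in> perms n" "t \<in> perms n" "b \<in> pair s" "b \<in> pair t" "s n = t n"
      using that(1,2) *(1-3) bspec[OF *(5), of s] bspec[OF *(5), of t] by (auto simp: pair_def)
    show False using cross_collision(1)[OF st(1,2) _ st(3,4) eq that(3)] n st(5) by simp
  qed
  then have "\<exists>s\<in>{u, v, w}. s \<noteq> x \<and> cross n s b \<noteq> y" using *(4) by (metis distinct_length_2_or_more insert_iff)
  then obtain s where s: "s \<in> {u, v, w}" "s \<noteq> x" "cross n s b \<noteq> y" by blast
  then show ?thesis using that[of s] * by (auto simp: copies_def pair_def)
qed

text \<open>The copies are visited in list order, each in one stretch. Only within a single copy
  must the ends be known to differ; \<open>bridge\<close> ensures this for the last copy.\<close>

lemma hp_chain_list:
  assumes "distinct (a # as)" "set (a # as) \<subseteq> {1..n}" "x \<in> copies n {a}" "y \<in> copies n {last (a # as)}"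
    "as = [] \<Longrightarrow> x \<noteq> y"
  shows "hp n (copies n (set (a # as))) x y"
  using assms
proof (induction as arbitrary: a x)
  case Nil
  then show ?case using hp_copy by simp
next
  case (Cons b as)
  obtain s where s: "s \<in> copies n {a}" "s \<noteq> x" "b \<in> pair s" "cross n s b \<noteq> y"
    using bridge[of a b x y] Cons.prems by auto
  have sp: "s \<in> perms n" using s by (simp add: copies_def)
  have "cross n s b \<in> copies n {b}" using cross_in_copies[OF sp _ s(3)] n by simp
  then have "hp n (copies n (set (b # as))) (cross n s b) y"
    using Cons.prems s(4) by (intro Cons.IH) auto
  moreover have "hp n (copies n {a}) x s" using hp_copy[OF Cons.prems(3) s(1)] s(2) by simp
  moreover have "adj n s (cross n s b)" using adj_cross[OF sp] n by simp
  moreover have "copies n {a} \<inter> copies n (set (b # as)) = {}" using Cons.prems(1) by (intro copies_disjoint) auto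
  ultimately have "hp n (copies n {a} \<union> copies n (set (b # as))) x y" by (intro ham_path_join)
  moreover have "{a} \<union> set (b # as) = set (a # b # as)" by auto
  ultimately show ?case using copies_Un by metis
qed

text \<open>As each copy is visited in one stretch, ends in the same copy are allowed only if there
  is no other copy.\<close>

lemma hp_chain:
  assumes "X \<subseteq> {1..n}" "x \<in> copies n {a}" "y \<in> copies n {b}" "a \<in> X" "b \<in> X" "x \<noteq> y" "a = b \<Longrightarrow> X = {a}"
  shows "hp n (copies n X) x y"
proof (cases "a = b")
  case True
  then show ?thesis using assms hp_copy by auto
next
  case False
  have "finite (X - {a, b})" using finite_subset[OF assms(1)] by simp
  from finite_distinct_list[OF this] obtain as where as: "set as = X - {a, b}" "distinct as" by (elim exE conjE)
  have X: "set (a # (as @ [b])) = X" using as(1) assms(4,5) by auto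
  have "hp n (copies n (set (a # (as @ [b])))) x y"
  proof (rule hp_chain_list)
    show "distinct (a # (as @ [b]))" using as False by simp
    show "set (a # (as @ [b])) \<subseteq> {1..n}" using X assms(1) by simp
  qed (use assms(2,3) in simp_all)
  then show ?thesis using X by simp
qed

(* A single vertex (u = v) is allowed: it is inserted between the two copies. *)
lemma hc_extend:
  assumes D: "hp n D u v" "D \<inter> copies n X = {}" "D \<subseteq> perms n"
    and X: "X \<subseteq> {1..n}" "a \<in> X" "b \<in> X" "a = b \<Longrightarrow> X = {a}"
    and ab: "a \<in> pair u" "b \<in> pair v" "cross n u a \<noteq> cross n v b"
  shows "hc n (D \<union> copies n X)"
proof -
  have uv: "u \<in> perms n" "v \<in> perms n" using ham_path_ends[OF D(1)] D(3) by auto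
  have "hp n (copies n X) (cross n v b) (cross n u a)"
    using X ab(3) cross_in_copies[OF uv(1) _ ab(1), of "{a}"] cross_in_copies[OF uv(2) _ ab(2), of "{b}"] n
    by (intro hp_chain[of X _ b _ a]) auto
  moreover have "adj n v (cross n v b)" "adj n (cross n u a) u"
    using adj_cross uv n adj_sym by simp_all
  ultimately have "hp n (D \<union> copies n X) u (cross n u a)" "adj n (cross n u a) u"
    using D by (auto intro: ham_path_join)
  moreover have "3 \<le> card (D \<union> copies n X)"
  proof -
    have "a \<in> {1..n}" using X by auto
    then have "card (copies n {a}) = fact m" using card_copies[of n "{a}"] n by simp
    moreover have "(4::nat) \<le> fact m" using fact_ge_self[of m] n(2) by linarith
    moreover have "card (copies n {a}) \<le> card (D \<union> copies n X)"
      using X ham_path_ends[OF D(1)] finite_copies by (intro card_mono) (auto simp: copies_def)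
    ultimately show ?thesis by linarith
  qed
  ultimately show ?thesis unfolding ham_cycle_def by blast
qed

text \<open>The first edge is replaced by a detour through all other copies, leaving at
  \<open>u\<close> and returning at its successor \<open>w\<close>. The ends of the path do not
  change.\<close>

lemma hp_insert:
  assumes S: "hp n S u v" "S \<subseteq> copies n {s}" "u \<noteq> v"
  shows "hp n (S \<union> copies n ({1..n} - {s})) u v"
proof -
  obtain w where w: "hp n (S - {u}) w v" "adj n u w" using ham_path_uncons[OF S(1,3)] .
  have uw: "u \<in> S" "w \<in> S" "u \<noteq> w" using ham_path_ends[OF S(1)] ham_path_ends[OF w(1)] by auto
  have p: "u \<in> perms n" "w \<in> perms n" and un: "u n = s" "w n = s" using S(2) uw by (auto simp: copies_def)
  \<comment> \<open>Whichever symbol \<open>b\<close> of \<open>w\<close> is taken, one of the two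
    symbols of \<open>u\<close> differs from it.\<close>
  obtain a b where ab: "a \<in> pair u" "b \<in> pair w" "a \<noteq> b"
    using p perms_eq_iff[of u n 1 2] by (auto simp: pair_def)
  have sub: "pair u \<subseteq> {1..n} - {s}" "pair w \<subseteq> {1..n} - {s}"
    using pair_subset[OF p(1)] pair_subset[OF p(2)] nth_notin_pair[OF p(1), of n] nth_notin_pair[OF p(2), of n] un n by auto
  have 1: "cross n u a \<in> copies n {a}" "cross n w b \<in> copies n {b}"
    using cross_in_copies p ab n by auto
  then have "hp n (copies n ({1..n} - {s})) (cross n u a) (cross n w b)"
    using ab sub by (intro hp_chain[of _ _ a _ b]) (auto simp: copies_def)
  moreover have "adj n (cross n w b) w" and au: "adj n u (cross n u a)" using adj_cross p n adj_sym by simp_all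
  moreover have disj: "copies n ({1..n} - {s}) \<inter> S = {}" using S(2) by (auto simp: copies_def)
  ultimately have "hp n (copies n ({1..n} - {s}) \<union> (S - {u})) (cross n u a) v"
    using w by (intro ham_path_join) auto
  then have "hp n (insert u (copies n ({1..n} - {s}) \<union> (S - {u}))) u v"
    using au uw disj by (intro ham_path_cons) auto
  moreover have "insert u (copies n ({1..n} - {s}) \<union> (S - {u})) = S \<union> copies n ({1..n} - {s})" using uw by auto
  ultimately show ?thesis by simp
qed

text \<open>The removed set \<open>W\<close> stays the same one dimension up; this is how
  \<open>deletable\<close> is inherited.\<close>

lemma hp_insert_Suc:
  assumes "hp m (perms m - W) u v" "u \<noteq> v" "W \<subseteq> perms m"
  shows "hp n (perms n - W) u v"
proof -
  have "copies n {n} = perms m" using copies_last n(1) by simp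
  moreover have "{1..n} = {n} \<union> ({1..n} - {n})" using n by auto
  then have "perms n = copies n {n} \<union> copies n ({1..n} - {n})" 
    using copies_all[of n] copies_Un[of n "{n}" "{1..n} - {n}"] n by simp
  moreover have "copies n {n} \<inter> copies n ({1..n} - {n}) = {}" by (intro copies_disjoint) auto
  ultimately have "perms m - W \<union> copies n ({1..n} - {n}) = perms n - W" using assms(3) by auto
  then show ?thesis
    using hp_insert[OF hp_Suc[OF assms(1), folded n(1)], of n] assms copies_last n(1) by auto
qed

text \<open>Ends in different copies are joined by a chain through all copies, ends in the same copy
  by a path of that copy with the detour of \<open>hp_insert\<close>.\<close>

lemma ham_connected_Suc: "ham_connected n"
  unfolding ham_connected_def
proof (intro ballI impI)
  fix x y assume xy: "x \<in> perms n" "y \<in> perms n" "x \<noteq> y"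
  have all: "copies n {1..n} = perms n" using copies_all n by simp
  have r: "x n \<in> {1..n}" "y n \<in> {1..n}" using perms_last xy n by auto
  have c: "x \<in> copies n {x n}" "y \<in> copies n {y n}" using xy by (auto simp: copies_def)
  show "hp n (perms n) x y"
  proof (cases "x n = y n")
    case False
    then show ?thesis using hp_chain[of "{1..n}" x "x n" y "y n"] r c xy all by auto
  next
    case True
    then have "hp n (copies n {x n}) x y" using hp_copy c xy by simp
    then have "hp n (copies n {x n} \<union> copies n ({1..n} - {x n})) x y" using hp_insert xy by blast
    moreover have "{x n} \<union> ({1..n} - {x n}) = {1..n}" using r by auto
    ultimately show ?thesis using copies_Un all by metis
  qed
qed

end

section \<open>Pieces\<close>

text \<open>The string 2 3 1 4 5 ..., the neighbour of the identity along type (ii) with i = 3. The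
  edge between them serves as the piece of two vertices.\<close>

definition rot3 :: "nat \<Rightarrow> nat" where "rot3 = id(1 := 2, 2 := 3, 3 := 1)"

(* The condition on an edge makes its ends have neighbours in three different copies one dimension up. *)
definition piece :: "nat \<Rightarrow> (nat \<Rightarrow> nat) set \<Rightarrow> bool" where
  "piece n D \<longleftrightarrow> hc n D \<or> (\<exists>x\<in>perms n. D = {x}) \<or> (\<exists>x y. D = {x, y} \<and> adj n x y \<and> pair x \<noteq> pair y)"

text \<open>One dimension up, \<open>D\<close> can be traversed between an arrival from copy
  \<open>a\<close> and a departure to copy \<open>b\<close>. A single vertex is covered by
  \<open>u = v\<close>.\<close>

definition ends :: "nat \<Rightarrow> (nat \<Rightarrow> nat) set \<Rightarrow> nat \<Rightarrow> nat \<Rightarrow> bool" where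
  "ends n D a b \<longleftrightarrow> (\<exists>u v. hp n D u v \<and> a \<in> pair u \<and> b \<in> pair v)"

definition splittable :: "nat \<Rightarrow> bool" where
  "splittable n \<longleftrightarrow> (\<forall>h\<in>perms n. h \<noteq> id \<longrightarrow> (\<forall>r. 1 \<le> r \<longrightarrow> r < fact n \<longrightarrow>
     (\<exists>D\<subseteq>perms n. card D = r \<and> piece n D \<and> piece n (perms n - D) \<and> (\<exists>x\<in>D. x \<circ> h \<notin> D))))"

definition bipartition :: "nat \<Rightarrow> (nat \<Rightarrow> nat) \<Rightarrow> nat \<Rightarrow> bool" where
  "bipartition n g l \<longleftrightarrow> (\<exists>C\<subseteq>perms n. card C = l \<and> hc n C \<and> hc n (perms n - C) \<and> (\<exists>x\<in>C. x \<circ> g \<notin> C))"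

lemma piece_arc:
  assumes "piece n D" "x \<in> D"
  shows "D = {x} \<or> (\<exists>y. hp n D x y \<and> adj n x y \<and> pair x \<noteq> pair y)"
proof -
  consider "hc n D" | z where "D = {z}" | u v where "D = {u, v}" "adj n u v" "pair u \<noteq> pair v"
    using assms(1) by (auto simp: piece_def)
  then show ?thesis
  proof cases
    case 1
    then show ?thesis using hc_arc[OF _ assms(2)] by blast
  next
    case 3
    have e: "hp n {a, b} a b" if "adj n a b" "a \<noteq> b" for a b
      using ham_path_cons[of "adj n" "{b}" b b a] ham_path.single[of "adj n" b] that by simp
    have "hp n D u v" "hp n D v u"
      using e[of u v] e[of v u] 3 adj_sym by (auto simp: insert_commute)
    then show ?thesis using 3 assms(2) adj_sym by auto
  qed (use assms in auto)
qed

lemma piece_hc: "piece n D \<Longrightarrow> 3 \<le> card D \<Longrightarrow> hc n D"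
  by (auto simp: piece_def card_insert_if split: if_splits)

text \<open>\<open>T\<close> collects the symbols leading out of an edge at \<open>x\<close>: three
  in general, but only the two of \<open>x\<close> if \<open>D\<close> is a single vertex.\<close>

lemma piece_ends:
  assumes "piece n D" "x \<in> D"
  obtains T where "pair x \<subseteq> T" "T \<subseteq> \<Union> (pair ` D)" "D \<noteq> {x} \<Longrightarrow> card T = 3"
    "\<And>a b. a \<in> T \<Longrightarrow> b \<in> T \<Longrightarrow> a \<noteq> b \<Longrightarrow> ends n D a b"
proof (cases "D = {x}")
  case True
  have "hp n D x x" using True ham_path.single by simp
  then show ?thesis using that[of "pair x"] True by (auto simp: ends_def)
next
  case False
  then obtain y where y: "hp n D x y" "adj n x y" "pair x \<noteq> pair y" using piece_arc[OF assms] by blast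
  show ?thesis
  proof (rule that[of "pair x \<union> pair y"])
    show "pair x \<union> pair y \<subseteq> \<Union> (pair ` D)" using ham_path_ends[OF y(1)] by blast
    show "card (pair x \<union> pair y) = 3" using adj_pair_union y by blast
    show "ends n D a b" if "a \<in> pair x \<union> pair y" "b \<in> pair x \<union> pair y" "a \<noteq> b" for a b
      by (rule arc_choice[OF y that(3,1,2)]) (auto simp: ends_def)
  qed simp
qed

lemma two_distinct_outside:
  assumes "finite A" "card B + 2 \<le> card A" "finite B"
  obtains b b' where "b \<in> A" "b' \<in> A" "b \<notin> B" "b' \<notin> B" "b \<noteq> b'"
proof -
  have "2 \<le> card (A - B)" using diff_card_le_card_Diff[OF assms(3), of A] assms(2) by linarith
  then obtain T where "T \<subseteq> A - B" "card T = 2" by (rule obtain_subset_with_card_n)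
  moreover from this(2) obtain b b' where "T = {b, b'}" "b \<noteq> b'" by (auto simp: card_2_iff)
  ultimately show ?thesis using that[of b b'] by auto
qed

lemma disjoint_pair_exists:
  assumes "x \<in> perms m" "4 \<le> m"
  obtains y where "y \<in> perms m" "pair y \<inter> pair x = {}"
proof -
  obtain b b' where b: "b \<in> {1..m}" "b' \<in> {1..m}" "b \<notin> pair x" "b' \<notin> pair x" "b \<noteq> b'"
    by (rule two_distinct_outside[of "{1..m}" "pair x"]) (use card_pair[OF assms(1)] assms(2) in \<open>auto simp: pair_def\<close>)
  obtain y where "y \<in> perms m" "y 1 = b" "y 2 = b'" using perm_exists2[of 1 m 2 b b'] b assms by auto
  then show ?thesis using that[of y] b by (auto simp: pair_def)
qed

text \<open>This lets the whole copies be distributed so that each part gets the two copies it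
  needs. Two different three-element symbol sets leave enough room for disjoint choices.\<close>

lemma disjoint_ends:
  assumes m: "4 \<le> m" and D: "D \<subseteq> perms m" "D \<noteq> {}" "D \<noteq> perms m" "piece m D" "piece m (perms m - D)"
  obtains a a' b b' where "a \<noteq> a'" "b \<noteq> b'" "{a, a'} \<inter> {b, b'} = {}" "{a, a', b, b'} \<subseteq> {1..m}"
    "ends m D a a'" "ends m (perms m - D) b b'"
proof -
  let ?E = "perms m - D"
  note choose = that
  obtain x0 y0 where xy0: "x0 \<in> D" "y0 \<in> ?E" using D by blast
  have sub: "\<Union> (pair ` D) \<subseteq> {1..m}" "\<Union> (pair ` ?E) \<subseteq> {1..m}" using pair_subset[of _ m] D(1) m by fastforce+
  \<comment> \<open>Vertices with disjoint pairs already give the four symbols. This serves the case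
    of a single vertex on one side, which offers only two.\<close>
  have disj: thesis if xD: "x \<in> D" and yE: "y \<in> ?E" and xy: "pair y \<inter> pair x = {}" for x y
  proof -
    obtain T where T: "pair x \<subseteq> T" "T \<subseteq> \<Union> (pair ` D)" "\<And>a b. a \<in> T \<Longrightarrow> b \<in> T \<Longrightarrow> a \<noteq> b \<Longrightarrow> ends m D a b"
      using piece_ends[OF D(4) xD] by metis
    obtain T' where T': "pair y \<subseteq> T'" "T' \<subseteq> \<Union> (pair ` ?E)" "\<And>a b. a \<in> T' \<Longrightarrow> b \<in> T' \<Longrightarrow> a \<noteq> b \<Longrightarrow> ends m ?E a b"
      using piece_ends[OF D(5) yE] by metis
    have p: "x \<in> perms m" "y \<in> perms m" using xD yE D(1) by auto
    have "x 1 \<noteq> x 2" "y 1 \<noteq> y 2" using perms_eq_iff[OF p(1)] perms_eq_iff[OF p(2)] by simp_all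
    moreover have "x 1 \<in> T" "x 2 \<in> T" "y 1 \<in> T'" "y 2 \<in> T'" using T(1) T'(1) by (auto simp: pair_def)
    moreover have "{x 1, x 2} \<inter> {y 1, y 2} = {}" using xy by (auto simp: pair_def)
    moreover have "{x 1, x 2, y 1, y 2} \<subseteq> {1..m}" using pair_subset[OF p(1)] pair_subset[OF p(2)] m by (auto simp: pair_def)
    ultimately show thesis using T(3)[of "x 1" "x 2"] T'(3)[of "y 1" "y 2"] by (intro choose[of "x 1" "x 2" "y 1" "y 2"]) auto
  qed
  consider (one) x where "D = {x}" | (other) y where "?E = {y}" | (both) "\<forall>x. D \<noteq> {x}" "\<forall>y. ?E \<noteq> {y}" by blast
  then show thesis
  proof cases
    case one
    then obtain y where "y \<in> perms m" "pair y \<inter> pair x = {}" using disjoint_pair_exists[of x m] D(1) m by blast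
    moreover from this have "y \<noteq> x" by (auto simp: pair_def)
    ultimately show ?thesis using disj[of x y] one by blast
  next
    case other
    then obtain x where "x \<in> perms m" "pair x \<inter> pair y = {}" using disjoint_pair_exists[of y m] m by blast
    moreover from this have "x \<noteq> y" by (auto simp: pair_def)
    ultimately show ?thesis using disj[of x y] other by blast
  next
    case both
    have "\<forall>x\<in>D. \<exists>T. pair x \<subseteq> T \<and> T \<subseteq> \<Union> (pair ` D) \<and> card T = 3 \<and> (\<forall>a\<in>T. \<forall>b\<in>T. a \<noteq> b \<longrightarrow> ends m D a b)"
    proof
      fix x assume "x \<in> D"
      show "\<exists>T. pair x \<subseteq> T \<and> T \<subseteq> \<Union> (pair ` D) \<and> card T = 3 \<and> (\<forall>a\<in>T. \<forall>b\<in>T. a \<noteq> b \<longrightarrow> ends m D a b)"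
        by (rule piece_ends[OF D(4) \<open>x \<in> D\<close>]) (use both(1) in blast)
    qed
    then obtain T where T: "\<forall>x\<in>D. pair x \<subseteq> T x \<and> T x \<subseteq> \<Union> (pair ` D) \<and> card (T x) = 3 \<and>
        (\<forall>a\<in>T x. \<forall>b\<in>T x. a \<noteq> b \<longrightarrow> ends m D a b)"
      by (auto dest!: bchoice)
    have "\<forall>x\<in>?E. \<exists>T. pair x \<subseteq> T \<and> T \<subseteq> \<Union> (pair ` ?E) \<and> card T = 3 \<and> (\<forall>a\<in>T. \<forall>b\<in>T. a \<noteq> b \<longrightarrow> ends m ?E a b)"
    proof
      fix x assume "x \<in> ?E"
      show "\<exists>T. pair x \<subseteq> T \<and> T \<subseteq> \<Union> (pair ` ?E) \<and> card T = 3 \<and> (\<forall>a\<in>T. \<forall>b\<in>T. a \<noteq> b \<longrightarrow> ends m ?E a b)"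
        by (rule piece_ends[OF D(5) \<open>x \<in> ?E\<close>]) (use both(2) in blast)
    qed
    then obtain T' where T': "\<forall>x\<in>?E. pair x \<subseteq> T' x \<and> T' x \<subseteq> \<Union> (pair ` ?E) \<and> card (T' x) = 3 \<and>
        (\<forall>a\<in>T' x. \<forall>b\<in>T' x. a \<noteq> b \<longrightarrow> ends m ?E a b)"
      by (auto dest!: bchoice)
    \<comment> \<open>Otherwise one three-element set would contain the pairs of all vertices,
      though each of the at least four symbols comes first in some vertex.\<close>
    have "\<exists>x\<in>D. \<exists>y\<in>?E. T x \<noteq> T' y"
    proof (rule ccontr)
      assume "\<not> ?thesis"
      then have same: "T x = T' y" if "x \<in> D" "y \<in> ?E" for x y using that by blast
      have "card (T x0) = 3" using T xy0 by blast
      moreover have "card {1..m} \<ge> 4" using m by simp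
      ultimately have "\<not> {1..m} \<subseteq> T x0" using card_mono[of "T x0" "{1..m}"] card_ge_0_finite[of "T x0"] by fastforce
      then obtain c where c: "c \<in> {1..m}" "c \<notin> T x0" by blast
      obtain z where z: "z \<in> perms m" "z 1 = c" using perm_exists1[of 1 m c] c m by auto
      then have "c \<in> pair z" by (simp add: pair_def)
      moreover have "pair z \<subseteq> T x0" using T T' same[of z y0] same[of x0 y0] same[of x0 z] xy0 z(1) by blast
      ultimately show False using c by blast
    qed
    then obtain x y where xy: "x \<in> D" "y \<in> ?E" "T x \<noteq> T' y" by blast
    have c3: "card (T x) = 3" "card (T' y) = 3" using T T' xy by blast+
    then have fins: "finite (T x)" "finite (T' y)" using card_ge_0_finite by force+
    have "\<not> T' y \<subseteq> T x" using card_subset_eq[OF fins(1), of "T' y"] c3 xy(3) by auto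
    \<comment> \<open>As \<open>c\<close> is outside \<open>T x\<close>, only its companion
      \<open>d\<close> has to be avoided there, and \<open>T x\<close> has two further
      elements.\<close>
    then obtain c where c: "c \<in> T' y" "c \<notin> T x" by blast
    obtain d d' where d: "d \<in> T' y" "d' \<in> T' y" "d \<notin> {c}" "d' \<notin> {c}" "d \<noteq> d'"
      by (rule two_distinct_outside[of "T' y" "{c}"]) (use c3 fins in auto)
    obtain a a' where a: "a \<in> T x" "a' \<in> T x" "a \<notin> {d}" "a' \<notin> {d}" "a \<noteq> a'"
      by (rule two_distinct_outside[of "T x" "{d}"]) (use c3 fins in auto)
    have "T x \<subseteq> \<Union> (pair ` D)" "T' y \<subseteq> \<Union> (pair ` ?E)"
      using bspec[OF T xy(1)] bspec[OF T' xy(2)] by simp_all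
    with sub have in_m: "T x \<subseteq> {1..m}" "T' y \<subseteq> {1..m}" by simp_all
    show thesis
    proof (rule choose[of a a' c d])
      show "ends m D a a'" using bspec[OF T xy(1)] a by simp
      show "ends m ?E c d" using bspec[OF T' xy(2)] c d by simp
      show "{a, a', c, d} \<subseteq> {1..m}" using in_m a c d by blast
    qed (use a c d in auto)
  qed
qed

text \<open>Right multiplication by \<open>g\<close> is injective. If it mapped the finite
  complement into itself, it would map it onto itself, and no vertex of \<open>C\<close> could be
  sent there. So the parts of a partition may be interchanged.\<close>

lemma not_closed_complement:
  assumes C: "C \<subseteq> perms n" and g: "g \<in> perms n" and ex: "\<exists>x\<in>C. x \<circ> g \<notin> C"
  shows "\<exists>x\<in>perms n - C. x \<circ> g \<notin> perms n - C"
proof (rule ccontr)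
  let ?f = "\<lambda>x. x \<circ> g"
  assume "\<not> ?thesis"
  then have "?f ` (perms n - C) \<subseteq> perms n - C" by blast
  moreover have inj: "x = y" if "?f x = ?f y" for x y
    using that perms_inv_comp(1)[OF g] by (metis comp_assoc comp_id)
  ultimately have "?f ` (perms n - C) = perms n - C"
    using finite_perms by (intro endo_inj_surj) (auto intro: inj_onI)
  moreover obtain x where x: "x \<in> C" "x \<circ> g \<notin> C" using ex by blast
  ultimately have "?f x \<in> ?f ` (perms n - C)" using perms_comp g C by blast
  then show False using x inj by blast
qed

section \<open>Extending a split copy by whole copies\<close>

text \<open>Hence \<open>x\<close>, \<open>swap12 x\<close> and their neighbours in the copy named
  \<open>a\<close> form a 4-cycle, which \<open>hp_attach_edge\<close> uses.\<close>

lemma cross_swap12: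
  assumes "x \<in> perms n" "3 \<le> n" "a \<in> pair x"
  shows "cross n (swap12 x) a = swap12 (cross n x a)"
proof
  fix i
  show "cross n (swap12 x) a i = swap12 (cross n x a) i"
    using assms(2,3) perms_eq_iff[OF assms(1), of 1 2] by (auto simp: cross_def swap12_def pair_def)
qed

lemma pair_rot3: "pair rot3 = {2, 3}"
  by (simp add: pair_def rot3_def)

lemma pair_id: "pair id = {1, 2}"
  by (simp add: pair_def)

lemma rot3_eq: "rot3 = transpose 1 2 \<circ> transpose 2 3"
  by (rule ext) (auto simp: rot3_def transpose_def)

lemma rot3_in_perms: "3 \<le> n \<Longrightarrow> rot3 \<in> perms n"
  unfolding rot3_eq by (intro perms_comp perms_transpose) auto

lemma adj_id_rot3: "3 \<le> n \<Longrightarrow> adj n id rot3"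
  by (simp add: adj_def id_in_perms rot3_in_perms split_star_adj_def) (auto simp: rot3_def intro!: bexI[of _ 3])

lemma rot3_rot3: "rot3 \<circ> rot3 \<noteq> id" "rot3 \<circ> rot3 \<noteq> rot3" "rot3 \<noteq> id"
proof -
  have "(rot3 \<circ> rot3) 1 = 3" "rot3 1 = 2" by (simp_all add: rot3_def)
  then show "rot3 \<circ> rot3 \<noteq> id" "rot3 \<circ> rot3 \<noteq> rot3" "rot3 \<noteq> id" by (metis id_apply numeral_eq_one_iff num.distinct(3) numeral_eq_iff, metis numeral_eq_iff num.distinct(5), metis id_apply numeral_eq_one_iff num.distinct(1))
qed

lemma singleton_moved: "g \<in> perms m \<Longrightarrow> g \<noteq> id \<Longrightarrow> \<exists>x\<in>perms m - {id}. x \<circ> g \<in> {id}"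
  by (rule bexI[of _ "inv g"]) (auto simp: perms_inv_comp perms_inv dest: perms_inv_comp(1))

text \<open>\<open>inv g\<close> is sent to \<open>id\<close>. It fails only if it equals
  \<open>rot3\<close>; then \<open>rot3 \<circ> rot3\<close> is sent to \<open>rot3\<close>, and it
  lies outside because \<open>rot3\<close> has order 3.\<close>

lemma rot3_moved:
  assumes g: "g \<in> perms m" "g \<noteq> id" and m: "3 \<le> m"
  shows "\<exists>x\<in>perms m - {id, rot3}. x \<circ> g \<in> {id, rot3}"
proof (cases "inv g = rot3")
  case False
  have "inv g \<noteq> id" using perms_inv_comp(2)[OF g(1)] g(2) by auto
  then show ?thesis using False perms_inv_comp(2)[OF g(1)] perms_inv[OF g(1)] by (intro bexI[of _ "inv g"]) auto
next
  case True
  have "(rot3 \<circ> inv g) \<circ> g = rot3" using perms_inv_comp(2)[OF g(1)] by (simp add: comp_assoc)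
  then have "(rot3 \<circ> rot3) \<circ> g = rot3" using True by simp
  then show ?thesis using rot3_rot3 rot3_in_perms[OF m] by (intro bexI[of _ "rot3 \<circ> rot3"]) (auto intro: perms_comp)
qed

context split_star_step
begin

lemma perms_m: "perms m = copies n {n}"
  using copies_last n(1) by simp

lemma perms_n_Un: "perms n = perms m \<union> copies n {1..m}"
proof -
  have "{1..n} = {n} \<union> {1..m}" using n by auto
  then show ?thesis using copies_all[of n] copies_Un[of n "{n}" "{1..m}"] n perms_m by simp
qed

lemma in_perms_m: "x \<in> perms m \<longleftrightarrow> x \<in> perms n \<and> x n = n"
  by (auto simp: perms_m copies_def)

lemma extend_complement:
  assumes "D \<subseteq> perms m" "X \<subseteq> {1..m}"
  shows "perms n - (D \<union> copies n X) = (perms m - D) \<union> copies n ({1..m} - X)"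
proof -
  have "x n \<notin> X" if "x \<in> perms m" for x using that assms(2) n by (auto simp: in_perms_m)
  moreover have "x \<notin> D" if "x n \<in> {1..m}" for x using that assms(1) n by (auto simp: in_perms_m)
  ultimately show ?thesis unfolding perms_n_Un using perms_n_Un assms(1) by (auto simp: copies_def)
qed

lemma disjoint_copies:
  assumes "D \<subseteq> perms m" "X \<subseteq> {1..m}"
  shows "D \<inter> copies n X = {}"
proof -
  have "x n \<notin> X" if "x \<in> D" for x
  proof -
    have "x n = n" using that assms(1) in_perms_m by blast
    then show ?thesis using assms(2) n by auto
  qed
  then show ?thesis by (auto simp: copies_def)
qed

lemma card_extend:
  assumes "D \<subseteq> perms m" "X \<subseteq> {1..m}"
  shows "card (D \<union> copies n X) = card D + card X * fact m"
proof -
  have "D \<inter> copies n X = {}" by (rule disjoint_copies[OF assms])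
  moreover have "finite D" using assms(1) finite_perms finite_subset by metis
  moreover have "X \<subseteq> {1..n}" using assms(2) n by auto
  then have "card (copies n X) = card X * fact m" using card_copies[of n X] n by simp
  ultimately show ?thesis by (simp add: card_Un_disjoint finite_copies)
qed

lemma fixing_last: "g \<in> perms n \<Longrightarrow> g n = n \<Longrightarrow> g \<in> perms m"
  by (simp add: in_perms_m)

lemma moving_last:
  assumes g: "g \<in> perms n" "g n \<noteq> n" and ab: "a \<in> {1..n}" "b \<in> {1..n}" "a \<noteq> b"
  obtains x where "x \<in> perms n" "x n = a" "(x \<circ> g) n = b"
proof -
  have "g n \<in> {1..n}" using perms_last[OF g(1)] n by simp
  then obtain x where "x \<in> perms n" "x n = a" "x (g n) = b" using perm_exists2[of n n "g n" a b] ab g(2) n by auto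
  then show ?thesis using that[of x] by simp
qed

lemma piece_extend_all:
  assumes "D \<subseteq> perms m" "D \<noteq> {}" "piece m D"
  shows "hc n (D \<union> copies n {1..m})"
proof -
  obtain x where x: "x \<in> D" using assms(2) by blast
  obtain T where T: "pair x \<subseteq> T" "\<And>a b. a \<in> T \<Longrightarrow> b \<in> T \<Longrightarrow> a \<noteq> b \<Longrightarrow> ends m D a b"
    by (rule piece_ends[OF assms(3) x]) blast
  have xp: "x \<in> perms m" using x assms(1) by blast
  have "x 1 \<in> T" "x 2 \<in> T" "x 1 \<noteq> x 2" using T(1) perms_eq_iff[OF xp] by (auto simp: pair_def)
  then obtain u v where uv: "hp m D u v" "x 1 \<in> pair u" "x 2 \<in> pair v" using T(2) unfolding ends_def by blast
  have p: "u \<in> perms n" "v \<in> perms n" using ham_path_ends[OF uv(1)] assms(1) by (auto simp: in_perms_m)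
  have "cross n u (x 1) n = x 1" "cross n v (x 2) n = x 2" using cross_last uv(2,3) n by simp_all
  then have neq: "cross n u (x 1) \<noteq> cross n v (x 2)" using \<open>x 1 \<noteq> x 2\<close> by auto
  have "x 1 \<in> {1..m}" "x 2 \<in> {1..m}" using pair_subset[OF xp] n by (auto simp: pair_def)
  then show ?thesis
    using assms(1) n neq \<open>x 1 \<noteq> x 2\<close> uv
    by (intro hc_extend[OF hp_Suc[OF uv(1), folded n(1)], of "{1..m}" "x 1" "x 2"]) (auto simp: in_perms_m copies_def)
qed

text \<open>The short cycle lies inside the copy fixing n; the rest of that copy is closed up
  through all other copies.\<close>

lemma bipartition_small:
  assumes sp: "splittable m" and g: "g \<in> perms n" "g \<noteq> id" and l: "3 \<le> l" "l < fact m"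
  shows "bipartition n g l"
proof -
  \<comment> \<open>If \<open>g\<close> moves n, it carries every vertex of this copy out of it, so
    any nontrivial \<open>h\<close> will do.\<close>
  obtain h where h: "h \<in> perms m" "h \<noteq> id" "g n = n \<Longrightarrow> h = g"
  proof (cases "g n = n")
    case False
    show ?thesis
      by (rule that[of "transpose 1 2"])
        (use False n in \<open>auto simp: perms_transpose fun_eq_iff transpose_def intro: exI[of _ 1]\<close>)
  qed (use that[of g] g fixing_last in auto)
  obtain D where D: "D \<subseteq> perms m" "card D = l" "piece m D" "piece m (perms m - D)" "\<exists>x\<in>D. x \<circ> h \<notin> D"
    using sp h l unfolding splittable_def by (meson le_trans numeral_le_one_iff one_le_numeral)
  have "perms m - D \<noteq> {}" using D(1,2) l(2) card_perms[of m] by auto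
  then have "hc n ((perms m - D) \<union> copies n {1..m})" using piece_extend_all D(4) by simp
  then have "hc n (perms n - D)" using extend_complement[OF D(1), of "{}"] by (simp add: copies_def)
  moreover have "hc n D" using hc_Suc[OF piece_hc[OF D(3)]] D(2) l n by simp
  moreover have "\<exists>x\<in>D. x \<circ> g \<notin> D"
  proof (cases "g n = n")
    case True
    then show ?thesis using D(5) h(3) by simp
  next
    case False
    obtain x where x: "x \<in> D" using D(5) by blast
    then have xn: "x \<in> perms n" "x n = n" using D(1) in_perms_m by blast+
    then have "(x \<circ> g) n \<noteq> n" using perms_eq_iff[OF xn(1), of "g n" n] False by simp
    then have "x \<circ> g \<notin> D" using D(1) in_perms_m by blast
    then show ?thesis using x by blast
  qed
  moreover have "D \<subseteq> perms n" using D(1) in_perms_m by blast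
  ultimately show ?thesis using D(2) unfolding bipartition_def by blast
qed

text \<open>If \<open>g\<close> moves n, some vertex with last symbol in \<open>X\<close> is sent to
  one whose last symbol is in \<open>{1..m}\<close> but not in \<open>X\<close>; hence both sides
  need a whole copy.\<close>

lemma bipartition_of_extension:
  assumes g: "g \<in> perms n" "g \<noteq> id" and D: "D \<subseteq> perms m"
    and X: "X \<subseteq> {1..m}" "X \<noteq> {}" "X \<noteq> {1..m}"
    and moved: "g n = n \<Longrightarrow> \<exists>x\<in>D. x \<circ> g \<notin> D"
    and hc: "hc n (D \<union> copies n X)" "hc n ((perms m - D) \<union> copies n ({1..m} - X))"
  shows "bipartition n g (card D + card X * fact m)"
proof -
  let ?C = "D \<union> copies n X"
  have "\<exists>x\<in>?C. x \<circ> g \<notin> ?C"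
  proof (cases "g n = n")
    case True
    then obtain x where x: "x \<in> D" "x \<circ> g \<notin> D" using moved by blast
    then have "(x \<circ> g) n = n" using True D in_perms_m by auto
    then have "x \<circ> g \<notin> copies n X" using X(1) n by (auto simp: copies_def)
    then show ?thesis using x by blast
  next
    case False
    obtain a b where ab: "a \<in> X" "b \<in> {1..m}" "b \<notin> X" using X by blast
    then have "a \<in> {1..n}" "b \<in> {1..n}" "a \<noteq> b" using X(1) n by auto
    then obtain x where x: "x \<in> perms n" "x n = a" "(x \<circ> g) n = b" using moving_last[OF g(1) False] by blast
    have "x \<in> ?C" using x(1,2) ab by (simp add: copies_def)
    moreover have "x \<circ> g \<notin> ?C"
      using x(3) ab D n in_perms_m[of "x \<circ> g"] by (auto simp: copies_def)
    ultimately show ?thesis by blast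
  qed
  moreover have "?C \<subseteq> perms n" using D in_perms_m copies_subset by blast
  ultimately show ?thesis
    using hc extend_complement[OF D X(1)] card_extend[OF D X(1)] unfolding bipartition_def by metis
qed

lemma ends_extend:
  assumes "ends m D a b" "a \<noteq> b" "D \<subseteq> perms m" "X \<subseteq> {1..m}" "a \<in> X" "b \<in> X"
  shows "hc n (D \<union> copies n X)"
proof -
  obtain u v where uv: "hp m D u v" "a \<in> pair u" "b \<in> pair v" using assms(1) by (auto simp: ends_def)
  have "cross n u a n = a" "cross n v b n = b" using cross_last uv(2,3) n by simp_all
  then have neq: "cross n u a \<noteq> cross n v b" using assms(2) by auto
  have disj: "D \<inter> copies n X = {}" by (rule disjoint_copies[OF assms(3,4)])
  have sub: "D \<subseteq> perms n" "X \<subseteq> {1..n}" using assms(3,4) n in_perms_m by auto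
  show ?thesis
    using hc_extend[OF hp_Suc[OF uv(1), folded n(1)] disj sub assms(5,6) _ uv(2,3) neq] assms(2) by blast
qed

text \<open>With one copy available both ends must enter it, so they need a common symbol. Colliding
  vertices lie in different copies, which \<open>x\<close> and \<open>y\<close> do not.\<close>

lemma common_extend:
  assumes "hp m D x y" "adj m x y" "a \<in> pair x" "a \<in> pair y" "D \<subseteq> perms m" "a \<in> {1..m}" "x \<noteq> y"
  shows "hc n (D \<union> copies n {a})"
proof -
  have xy: "x \<in> perms n" "y \<in> perms n" "x n = y n" using assms(2) in_perms_m by (auto simp: adj_def)
  have neq: "cross n x a \<noteq> cross n y a"
    using cross_collision(1)[OF xy(1,2) _ assms(3,4) _ assms(7)] xy(3) n by auto
  have disj: "D \<inter> copies n {a} = {}" using disjoint_copies[OF assms(5)] assms(6) by blast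
  have sub: "D \<subseteq> perms n" "{a} \<subseteq> {1..n}" using assms(5,6) n in_perms_m by auto
  show ?thesis
    using hc_extend[OF hp_Suc[OF assms(1), folded n(1)] disj sub _ _ _ assms(3,4) neq] by simp
qed

text \<open>For q at least 2 both parts receive at least two whole copies and can use two different
  symbols. For q = 1 the first part must leave to and return from the same copy, which a single
  vertex cannot do.\<close>

lemma bipartition_main:
  assumes sp: "splittable m" and g: "g \<in> perms n" "g \<noteq> id"
    and q: "1 \<le> q" "q \<le> m - 2" and r: "1 \<le> r" "r < fact m" "q = 1 \<Longrightarrow> r \<noteq> 1"
  shows "bipartition n g (r + q * fact m)"
proof -
  obtain h where h: "h \<in> perms m" "h \<noteq> id" "g n = n \<Longrightarrow> h = g"
  proof (cases "g n = n")
    case False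
    show ?thesis
      by (rule that[of "transpose 1 2"])
        (use False n in \<open>auto simp: perms_transpose fun_eq_iff transpose_def intro: exI[of _ 1]\<close>)
  qed (use that[of g] g fixing_last in auto)
  obtain D where D: "D \<subseteq> perms m" "card D = r" "piece m D" "piece m (perms m - D)" "\<exists>x\<in>D. x \<circ> h \<notin> D"
    using sp h r unfolding splittable_def by meson
  have moved: "g n = n \<Longrightarrow> \<exists>x\<in>D. x \<circ> g \<notin> D" using D(5) h(3) by simp
  let ?E = "perms m - D"
  have ne: "D \<noteq> {}" "D \<noteq> perms m" using D(2) r card_perms[of m] by auto
  have "\<exists>X\<subseteq>{1..m}. card X = q \<and> X \<noteq> {1..m} \<and> hc n (D \<union> copies n X) \<and> hc n (?E \<union> copies n ({1..m} - X))"
  proof (cases "q = 1")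
    case False
    obtain a a' b b' where ab: "a \<noteq> a'" "b \<noteq> b'" "{a, a'} \<inter> {b, b'} = {}" "{a, a', b, b'} \<subseteq> {1..m}"
        "ends m D a a'" "ends m ?E b b'"
      by (rule disjoint_ends[OF n(2) D(1) ne D(3,4)])
    \<comment> \<open>\<open>X\<close> must contain \<open>a\<close>, \<open>a'\<close> and avoid
      \<open>b\<close>, \<open>b'\<close>; there is room for this when q is between 2 and m -
      2.\<close>
    have "card {a, a'} \<le> q" using False q ab(1) by simp
    moreover have "q \<le> card ({1..m} - {b, b'})" using q ab by (simp add: card_Diff_subset)
    ultimately obtain X where X: "{a, a'} \<subseteq> X" "X \<subseteq> {1..m} - {b, b'}" "card X = q"
      using exists_subset_between[of "{a, a'}" q "{1..m} - {b, b'}"] ab by auto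
    have "hc n (D \<union> copies n X)" using X D(1) by (intro ends_extend[OF ab(5,1)]) auto
    moreover have "hc n (?E \<union> copies n ({1..m} - X))" using X ab by (intro ends_extend[OF ab(6,2)]) auto
    ultimately show ?thesis using X ab(4) by (intro exI[of _ X]) auto
  next
    case True
    then have r2: "D \<noteq> {x}" for x using D(2) r by auto
    have arc: "\<exists>y. hp m D x y \<and> adj m x y \<and> pair x \<noteq> pair y" if "x \<in> D" for x
      using piece_arc[OF D(3) that] r2 by blast
    \<comment> \<open>The common symbol \<open>a\<close> names the copy given to \<open>D\<close>;
      the complement must leave through two other symbols.\<close>
    have "\<exists>x y a b b'. hp m D x y \<and> adj m x y \<and> a \<in> pair x \<and> a \<in> pair y \<and> x \<noteq> y \<and>
        ends m ?E b b' \<and> b \<noteq> b' \<and> b \<in> {1..m} - {a} \<and> b' \<in> {1..m} - {a}"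
    proof (cases "\<exists>z. ?E = {z}")
      case True
      then obtain z where z: "?E = {z}" by blast
      then have zp: "z \<in> perms m" by blast
      \<comment> \<open>\<open>z\<close> needs both of its symbols, so \<open>a\<close> has to be
        taken from a pair disjoint from them.\<close>
      obtain x where x: "x \<in> perms m" "pair x \<inter> pair z = {}" by (rule disjoint_pair_exists[OF zp n(2)])
      then have "x \<in> D" using z by (auto simp: pair_def)
      then obtain y where y: "hp m D x y" "adj m x y" "pair x \<noteq> pair y" using arc by blast
      obtain a where a: "a \<in> pair x" "a \<in> pair y" using adj_pair_common[OF y(2)] by blast
      have "hp m ?E z z" unfolding z by (rule ham_path.single)
      then have "ends m ?E (z 1) (z 2)" unfolding ends_def by (auto simp: pair_def)
      moreover have "z 1 \<noteq> z 2" using perms_eq_iff[OF zp] by simp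
      moreover have "z 1 \<in> {1..m} - {a}" "z 2 \<in> {1..m} - {a}"
        using pair_subset[OF zp] n x a by (auto simp: pair_def)
      ultimately show ?thesis using y a by blast
    next
      case False
      obtain x z where x: "x \<in> D" and z: "z \<in> ?E" using ne D(1) by blast
      obtain y where y: "hp m D x y" "adj m x y" "pair x \<noteq> pair y" using arc x by blast
      obtain a where a: "a \<in> pair x" "a \<in> pair y" using adj_pair_common[OF y(2)] by blast
      obtain T where T: "T \<subseteq> \<Union> (pair ` ?E)" "?E \<noteq> {z} \<Longrightarrow> card T = 3"
          "\<And>a b. a \<in> T \<Longrightarrow> b \<in> T \<Longrightarrow> a \<noteq> b \<Longrightarrow> ends m ?E a b"
        by (rule piece_ends[OF D(4) z]) blast
      have c: "card T = 3" using T(2) False by blast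
      \<comment> \<open>At most one of the three symbols is lost to \<open>a\<close>.\<close>
      obtain b b' where b: "b \<in> T" "b' \<in> T" "b \<notin> {a}" "b' \<notin> {a}" "b \<noteq> b'"
        by (rule two_distinct_outside[of T "{a}"]) (use c card_ge_0_finite[of T] in auto)
      have "T \<subseteq> {1..m}" using T(1) pair_subset[of _ m] n by fastforce
      then show ?thesis using T(3)[OF b(1,2,5)] b a y by blast
    qed
    then obtain x y a b b' where *: "hp m D x y" "adj m x y" "a \<in> pair x" "a \<in> pair y" "x \<noteq> y"
        "ends m ?E b b'" "b \<noteq> b'" "b \<in> {1..m} - {a}" "b' \<in> {1..m} - {a}"
      by blast
    have a: "a \<in> {1..m}" using pair_subset[of x m] *(2,3) n by (auto simp: adj_def)
    have "hc n (D \<union> copies n {a})" by (rule common_extend[OF *(1-4) D(1) a *(5)])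
    moreover have "hc n (?E \<union> copies n ({1..m} - {a}))"
      by (rule ends_extend[OF *(6,7) _ _ *(8,9)]) auto
    moreover have "{a} \<noteq> {1..m}" using *(8) by blast
    ultimately show ?thesis using True a by (intro exI[of _ "{a}"] conjI) simp_all
  qed
  then obtain X where X: "X \<subseteq> {1..m}" "card X = q" "X \<noteq> {1..m}" "hc n (D \<union> copies n X)" "hc n (?E \<union> copies n ({1..m} - X))"
    by blast
  have "X \<noteq> {}" using X(2) q by auto
  then show ?thesis using bipartition_of_extension[OF g D(1) X(1) _ X(3) moved X(4,5)] X(2) D(2) by simp
qed

section \<open>Trading vertices for an edge of another copy\<close>

text \<open>The cycle runs through \<open>W\<close>, the copies of \<open>Y\<close> other than
  \<open>c'\<close>, then \<open>B\<close>, then copy \<open>c'\<close> and back to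
  \<open>W\<close>. Excluding \<open>t\<close> from the pairs of \<open>w\<close> and
  \<open>w'\<close> prevents them from sharing a neighbour with a vertex of
  \<open>B\<close>.\<close>

lemma hc_long_side:
  assumes W: "W \<subseteq> perms m" "hp m W w w'" "c \<in> pair w" "c' \<in> pair w'" "c \<noteq> c'" "t \<notin> pair w" "t \<notin> pair w'"
    and B: "B = copies n {t} - {z, swap12 z}" "z \<in> perms n" "n \<in> pair z" "t \<in> {1..m}" "hc n B"
    and Y: "Y \<subseteq> {1..m} - {t}" "c \<in> Y" "c' \<in> Y"
  shows "hc n (W \<union> B \<union> copies n Y)"
proof -
  \<comment> \<open>\<open>d\<close> names the copy visited just before \<open>B\<close>. It equals
    \<open>c\<close> only if \<open>c\<close> is the only copy left, as \<open>hp_chain\<close>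
    demands.\<close>
  obtain d where d: "d \<in> Y" "d \<noteq> c'" "d = c \<Longrightarrow> Y - {c'} = {c}"
  proof (cases "Y = {c, c'}")
    case True
    then show ?thesis using that[of c] W(5) by auto
  next
    case False
    then obtain e where "e \<in> Y" "e \<noteq> c" "e \<noteq> c'" using Y(2,3) by blast
    then show ?thesis using that[of e] by blast
  qed
  have bnd: "c' \<in> {1..n}" "d \<in> {1..n}" "t \<in> {1..n}" "distinct [c', d, t]" using Y d(1,2) B(4) n by auto
  \<comment> \<open>Neither \<open>c'\<close> nor \<open>d\<close> is n, so \<open>x\<close> is not
    one of the removed vertices \<open>z\<close> and \<open>swap12 z\<close>, whose pair contains
    n.\<close>
  then obtain x where x: "x \<in> perms n" "x 1 = c'" "x 2 = d" "x n = t"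
    using perm_exists3[of 1 n 2 n c' d t] n by auto
  have px: "pair x = {c', d}" using x by (simp add: pair_def)
  then have "n \<notin> pair x" using Y d n by auto
  then have "x \<in> B" using x B(1,3) pair_swap12[of z] by (auto simp: copies_def)
  then obtain y where y: "hp n B x y" "adj n x y" "pair x \<noteq> pair y" by (rule hc_arc[OF B(5)])
  obtain u v where uv: "hp n B u v" "adj n v u" "d \<in> pair u" "c' \<in> pair v" "{u, v} = {x, y}"
    by (rule arc_choice[OF y d(2)]) (use px in auto)
  have uvB: "u \<in> B" "v \<in> B" using ham_path_ends[OF uv(1)] by auto
  have uvp: "u \<in> perms n" "v \<in> perms n" "u n = t" "v n = t" using uvB B(1) by (auto simp: copies_def)
  have "w \<in> W" "w' \<in> W" using ham_path_ends[OF W(2)] by auto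
  then have wp: "w \<in> perms n" "w' \<in> perms n" "w n = n" "w' n = n" using W(1) in_perms_m by blast+
  have tn: "t \<noteq> n" using B(4) n by auto
  have no_collision: "cross n x e \<noteq> cross n y e"
    if "x \<in> perms n" "y \<in> perms n" "x n = n" "y n = t" "e \<in> pair x" "e \<in> pair y" "t \<notin> pair x" for x y e
  proof
    assume eq: "cross n x e = cross n y e"
    have "x \<noteq> y" using that(3,4) tn by auto
    then have "y n \<in> pair x" using cross_collision(3)[OF that(1,2) _ that(5,6) eq] n by simp
    then show False using that(4,7) by simp
  qed
  have neq1: "cross n w c \<noteq> cross n u d"
  proof (cases "c = d")
    case True
    then show ?thesis using no_collision[OF wp(1) uvp(1) wp(3) uvp(3) W(3)] uv(3) W(6) by simp
  next
    case False
    have "cross n w c n = c" "cross n u d n = d" using cross_last W(3) uv(3) n by simp_all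
    then show ?thesis using False by auto
  qed
  have neq2: "cross n v c' \<noteq> cross n w' c'"
    using no_collision[OF wp(2) uvp(2) wp(4) uvp(4) W(4) uv(4) W(7)] by simp
  have p1: "hp n (copies n (Y - {c'})) (cross n w c) (cross n u d)"
  proof (rule hp_chain[OF _ _ _ _ _ neq1])
    show "Y - {c'} \<subseteq> {1..n}" using Y(1) n by auto
    show "cross n w c \<in> copies n {c}" "cross n u d \<in> copies n {d}"
      using cross_in_copies wp(1) uvp(1) W(3) uv(3) n by auto
  qed (use Y d W(5) in auto)
  have p2: "hp n (copies n {c'}) (cross n v c') (cross n w' c')"
    using cross_in_copies[OF wp(2) _ W(4)] cross_in_copies[OF uvp(2) _ uv(4)] n neq2 by (intro hp_copy) auto
  have q: "hp n W w' w" using ham_path_rev[OF symp_adj W(2)] hp_Suc n(1) by simp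
  have a: "adj n w (cross n w c)" "adj n (cross n u d) u" "adj n v (cross n v c')" "adj n (cross n w' c') w'"
    using adj_cross wp uvp n adj_sym by simp_all
  have lastW: "x n = n" if "x \<in> W" for x using that W(1) in_perms_m by blast
  have lastB: "x n = t" if "x \<in> B" for x using that B(1) by (simp add: copies_def)
  have "W \<inter> copies n Y = {}" using W(1) Y(1) by (intro disjoint_copies) auto
  then have dW: "W \<inter> copies n (Y - {c'}) = {}" "W \<inter> copies n {c'} = {}" using Y(3) by (auto simp: copies_def)
  have dB: "B \<inter> copies n (Y - {c'}) = {}" "B \<inter> copies n {c'} = {}" "W \<inter> B = {}"
    using lastB lastW Y tn by (auto simp: copies_def)
  have dC: "copies n (Y - {c'}) \<inter> copies n {c'} = {}" by (intro copies_disjoint) auto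
  have dWCB: "(W \<union> copies n (Y - {c'})) \<inter> B = {}" using dB by blast
  have dWCBC: "(W \<union> copies n (Y - {c'}) \<union> B) \<inter> copies n {c'} = {}" using dW dB dC by blast
  have "hp n (W \<union> copies n (Y - {c'}) \<union> B \<union> copies n {c'}) w' (cross n w' c')"
    by (rule hp_join[OF hp_join[OF hp_join[OF q p1 a(1) dW(1)] uv(1) a(2) dWCB] p2 a(3) dWCBC])
  moreover have "W \<union> copies n (Y - {c'}) \<union> B \<union> copies n {c'} = W \<union> B \<union> copies n Y"
    using Y(3) by (auto simp: copies_def)
  ultimately have P: "hp n (W \<union> B \<union> copies n Y) w' (cross n w' c')" by simp
  have "card B \<le> card (W \<union> B \<union> copies n Y)" using ham_path_ends[OF P] by (intro card_mono) blast+
  then have "3 \<le> card (W \<union> B \<union> copies n Y)" using B(5) unfolding ham_cycle_def by linarith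
  then show ?thesis using P a(4) unfolding ham_cycle_def by blast
qed

text \<open>By the 4-cycle on \<open>y\<close>, \<open>swap12 y\<close>, \<open>swap12 z\<close>,
  \<open>z\<close> the new vertices extend the path at both ends, and their own edge closes
  it.\<close>

lemma hp_attach_edge:
  assumes D: "hp m D y (swap12 y)" "D \<subseteq> perms m" "t \<in> pair y" "t \<in> {1..m}" "z = cross n y t"
  shows "hp n (D \<union> {z, swap12 z}) z (swap12 z)" "adj n (swap12 z) z" "z \<in> copies n {t}" "swap12 z \<in> copies n {t}"
proof -
  have y: "y \<in> perms n" using ham_path_ends[OF D(1)] D(2) in_perms_m by blast
  have z: "z \<in> perms n" "z n = t" using cross_in_perms[OF y] cross_last[OF D(3)] D(5) n by simp_all
  have zs: "swap12 z \<in> perms n" "swap12 z n = t" using swap12_in_perms z n by (simp_all add: swap12_def)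
  show "z \<in> copies n {t}" "swap12 z \<in> copies n {t}" using z zs by (simp_all add: copies_def)
  have "swap12 z = cross n (swap12 y) t" using cross_swap12[OF y _ D(3)] D(5) n by simp
  then have a: "adj n y z" "adj n (swap12 y) (swap12 z)"
    using adj_cross y swap12_in_perms[OF y] n D(5) by simp_all
  have out: "x n = n" if "x \<in> D" for x using that D(2) in_perms_m by blast
  have "t \<noteq> n" using D(4) n by auto
  then have zD: "z \<notin> D" "swap12 z \<notin> insert z D" using out[of z] out[of "swap12 z"] z zs swap12_neq[OF z(1)] by auto
  have "hp n D y (swap12 y)" using hp_Suc[OF D(1)] n(1) by simp
  then have "hp n (insert (swap12 z) (insert z D)) z (swap12 z)"
    by (rule hp_snoc[OF hp_cons[OF _ adj_sym[OF a(1)] zD(1)] a(2) zD(2)])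
  then show "hp n (D \<union> {z, swap12 z}) z (swap12 z)" by (simp add: insert_commute)
  show "adj n (swap12 z) z" using adj_sym[OF adj_swap12[OF z(1)]] n by simp
qed

(* The first part of the partition gives up W and receives the edge {z, swap12 z} of the copy fixing t. *)
lemma bipartition_exchange:
  assumes g: "g \<in> perms n" "g \<noteq> id"
    and W: "W \<subseteq> {i, j}" "W \<subseteq> perms m" "hp m W w w'" "c \<in> pair w" "c' \<in> pair w'" "c \<noteq> c'" "t \<notin> pair w" "t \<notin> pair w'"
    and moved: "\<And>h. h \<in> perms m \<Longrightarrow> h \<noteq> id \<Longrightarrow> \<exists>x\<in>perms m - W. x \<circ> h \<in> W"
    and y: "hp m (perms m - W) y (swap12 y)" "t \<in> pair y" "t \<in> {1..m}" "z = cross n y t"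
    and del: "hc m (perms m - {id, swap12 id})"
    and X: "X \<subseteq> {1..m} - {t, c, c'}" "hc n ((perms m - W) \<union> {z, swap12 z} \<union> copies n X)"
  shows "bipartition n g (fact m - card W + 2 + card X * fact m)"
proof -
  let ?D = "perms m - W" and ?Y = "{1..m} - {t} - X" and ?B = "copies n {t} - {z, swap12 z}"
  let ?C = "?D \<union> {z, swap12 z} \<union> copies n X"
  have yp: "y \<in> perms n" using ham_path_ends[OF y(1)] in_perms_m by blast
  have z: "z \<in> copies n {t}" "swap12 z \<in> copies n {t}" by (rule hp_attach_edge[OF y(1) _ y(2-4)]; blast)+
  then have zp: "z \<in> perms n" "z n = t" "swap12 z n = t" by (auto simp: copies_def)
  \<comment> \<open>Passing from \<open>y\<close> to \<open>z\<close> brings the former last symbol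
    n into the first two positions.\<close>
  have nz: "n \<in> pair z"
    using pair_cross[OF yp y(2)] y(4) n ham_path_ends[OF y(1)] in_perms_m[of y] by auto
  \<comment> \<open>Translation by \<open>z\<close> takes the copy fixing n to the copy fixing
    \<open>t\<close>, and the edge between \<open>id\<close> and \<open>swap12 id\<close> to the one
    given away.\<close>
  have hcB: "hc n ?B"
  proof -
    have "hc n ((\<circ>) z ` (perms m - {id, swap12 id}))"
      using hc_left[OF hc_Suc[OF del]] zp(1) n(1) by simp
    moreover have "(\<circ>) z ` perms m = copies n {t}" using copies_left[OF zp(1), of "{n}"] zp(2) perms_m by simp
    moreover have "(\<circ>) z ` (perms m - {id, swap12 id}) = (\<circ>) z ` perms m - (\<circ>) z ` {id, swap12 id}"
      by (rule inj_on_image_set_diff[OF inj_on_left[OF zp(1), of UNIV]]) auto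
    moreover have "(\<circ>) z ` {id, swap12 id} = {z, swap12 z}" by (simp add: swap12_comp)
    ultimately show ?thesis by simp
  qed
  have "w \<in> perms m" "w' \<in> perms m" using ham_path_ends[OF W(3)] W(2) by auto
  then have cc: "c \<in> {1..m}" "c' \<in> {1..m}"
    using subsetD[OF pair_subset W(4)] subsetD[OF pair_subset W(5)] n by simp_all
  have "hc n (W \<union> ?B \<union> copies n ?Y)"
    using hcB nz zp(1) y(3) W X(1) cc by (intro hc_long_side[OF W(2-8)]) auto
  moreover have compl: "perms n - ?C = W \<union> ?B \<union> copies n ?Y"
  proof -
    have nt: "n \<notin> X" "n \<notin> ?Y" "n \<noteq> t" using X(1) y(3) n by auto
    show ?thesis
    proof (rule set_eqI)
      fix x
      have "x \<in> perms n \<longleftrightarrow> x \<in> perms m \<or> x \<in> copies n {1..m}" by (subst perms_n_Un) blast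
      then consider "x \<in> perms m" "x \<in> perms n" "x n = n" | "x \<notin> perms m" "x \<in> perms n" "x n \<in> {1..m}"
        | "x \<notin> perms m" "x \<notin> perms n"
        using in_perms_m[of x] unfolding copies_def by blast
      then show "x \<in> perms n - ?C \<longleftrightarrow> x \<in> W \<union> ?B \<union> copies n ?Y"
      proof cases
        case 1
        then have "x \<noteq> z" "x \<noteq> swap12 z" using nt(3) zp by auto
        then show ?thesis using 1 nt n(1) by (simp add: copies_def)
      next
        case 2
        then have "x \<notin> W" using W(2) by blast
        moreover have "x \<in> {z, swap12 z} \<Longrightarrow> x n = t" using zp by blast
        moreover have "t \<notin> X" using X(1) by blast
        ultimately show ?thesis using 2 by (auto simp: copies_def)
      next
        case 3
        then show ?thesis using W(2) by (auto simp: copies_def)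
      qed
    qed
  qed
  ultimately have "hc n (perms n - ?C)" by simp
  moreover have "\<exists>x\<in>?C. x \<circ> g \<notin> ?C"
  proof (cases "g n = n")
    case True
    then obtain x where x: "x \<in> ?D" "x \<circ> g \<in> W" using moved[OF fixing_last[OF g(1)] g(2)] by blast
    then have "x \<circ> g \<in> perms n - ?C" unfolding compl by blast
    then show ?thesis using x by blast
  next
    case False
    have "c \<in> ?Y" using cc X(1) W(4,7) by auto
    have gn: "g n \<in> {1..n}" using perms_last[OF g(1)] n by simp
    \<comment> \<open>Last symbol n puts \<open>x\<close> into the copy fixing n, and
      \<open>x (g n) = c\<close> sends \<open>x \<circ> g\<close> into the complement.
      \<open>W\<close> has at most two vertices, so one of three candidates avoids it.\<close>
    have "\<exists>u\<in>perms n. \<exists>v\<in>perms n. \<exists>x\<in>perms n. distinct [u, v, x] \<and> (\<forall>x\<in>{u, v, x}. x n = n \<and> x (g n) = c)"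
      using perm_exists2_three[of n n "g n" n c] False gn cc n by auto
    then obtain u1 u2 u3 where u: "u1 \<in> perms n" "u2 \<in> perms n" "u3 \<in> perms n" "distinct [u1, u2, u3]"
        "\<forall>x\<in>{u1, u2, u3}. x n = n \<and> x (g n) = c"
      by blast
    have "\<exists>x\<in>{u1, u2, u3}. x \<noteq> i \<and> x \<noteq> j" using u(4) by (metis distinct_length_2_or_more insert_iff)
    then obtain x where x: "x \<in> {u1, u2, u3}" "x \<notin> W" using W(1) by blast
    then have xp: "x \<in> perms n" "x n = n" "x (g n) = c" using u by blast+
    then have "x \<in> ?D" using x(2) in_perms_m by blast
    moreover have "x \<circ> g \<in> perms n - ?C"
      unfolding compl using xp(3) \<open>c \<in> ?Y\<close> perms_comp[OF xp(1) g(1)] by (simp add: copies_def)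
    ultimately show ?thesis by blast
  qed
  moreover have "card ?C = fact m - card W + 2 + card X * fact m"
  proof -
    have fin: "finite W" "finite ?D" using W(2) finite_perms finite_subset by blast+
    have "card ?D = fact m - card W" using W(2) fin(1) by (simp add: card_Diff_subset card_perms)
    moreover have "?D \<inter> {z, swap12 z} = {}" using zp(2,3) y(3) in_perms_m n by auto
    moreover have "(?D \<union> {z, swap12 z}) \<inter> copies n X = {}"
      using zp(2,3) X(1) in_perms_m n by (auto simp: copies_def)
    moreover have "card (copies n X) = card X * fact m"
      using card_copies[of n X] X(1) n by fastforce
    moreover have "card {z, swap12 z} = 2" using swap12_neq[OF zp(1)] by auto
    ultimately show ?thesis using fin by (simp only: card_Un_disjoint finite_copies finite_UnI finite.intros)
  qed
  moreover have "?C \<subseteq> perms n" using z copies_subset in_perms_m by blast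
  ultimately show ?thesis using X(2) unfolding bipartition_def by blast
qed

end

section \<open>The induction step\<close>

(* Start vertices whose first two symbols, {3, 4} and {1, 4}, leave a way out of the removed vertices
   (id alone, or id and rot3) into two copies other than those reached from the start vertex. *)
definition start1 :: "nat \<Rightarrow> nat" where "start1 = id(1 := 3, 2 := 4, 3 := 1, 4 := 2)"
definition start2 :: "nat \<Rightarrow> nat" where "start2 = id(1 := 4, 2 := 1, 4 := 2)"

text \<open>Each path joins the ends of an edge of type (i), so it can take up an edge of another
  copy by \<open>hp_attach_edge\<close>. The last conjunct concerns the copy that gives this edge
  away.\<close>

definition deletable :: "nat \<Rightarrow> bool" where
  "deletable m \<longleftrightarrow> hp m (perms m - {id}) start1 (swap12 start1) \<and>
     hp m (perms m - {id, rot3}) start2 (swap12 start2) \<and> hc m (perms m - {id, swap12 id})"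

lemma pair_start: "pair start1 = {3, 4}" "pair start2 = {4, 1}"
  by (simp_all add: pair_def start1_def start2_def)

lemma adj_neq:
  assumes "adj n x y"
  shows "x \<noteq> y"
proof -
  obtain i where "i \<noteq> 1" "y 1 = x i"
  proof (cases "y 1 = x 2")
    case False
    then obtain i where "i \<in> {3..n}" "y 1 = x i"
      using assms unfolding adj_def split_star_adj_def by blast
    then show ?thesis using that[of i] by simp
  qed (use that[of 2] in simp)
  then show ?thesis using perms_eq_iff[of x n i 1] assms by (auto simp: adj_def)
qed

lemma hc_intro:
  assumes "hp n S a b" "adj n b a" "c \<in> S" "c \<noteq> a" "c \<noteq> b"
  shows "hc n S"
proof -
  have ab: "a \<in> S" "b \<in> S" "finite S" using ham_path_ends[OF assms(1)] by auto
  have "a \<noteq> b" using adj_neq[OF assms(2)] by blast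
  then have "card {a, b, c} = 3" using assms(4,5) by simp
  moreover have "card {a, b, c} \<le> card S" using ab assms(3) by (intro card_mono) auto
  ultimately show ?thesis using assms(1,2) by (auto simp: ham_cycle_def)
qed

lemma hc_deleted_start1:
  assumes "4 \<le> m" "deletable m"
  shows "hc m (perms m - {id})"
proof -
  have p: "hp m (perms m - {id}) start1 (swap12 start1)" using assms(2) by (simp add: deletable_def)
  have "start1 \<in> perms m" using ham_path_ends[OF p] by blast
  then have "adj m (swap12 start1) start1" using adj_sym[OF adj_swap12] assms(1) by simp
  moreover have "pair rot3 \<noteq> pair start1" by (simp add: pair_rot3 pair_start doubleton_eq_iff)
  then have "rot3 \<noteq> start1" "rot3 \<noteq> swap12 start1" by (metis pair_swap12)+
  ultimately show ?thesis
    using hc_intro[OF p, of rot3] rot3_in_perms[of m] rot3_rot3 assms(1) by simp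
qed

lemma hc_deleted_start2:
  assumes "4 \<le> m" "deletable m"
  shows "hc m (perms m - {id, rot3})"
proof -
  have p: "hp m (perms m - {id, rot3}) start2 (swap12 start2)" using assms(2) by (simp add: deletable_def)
  have "start2 \<in> perms m" using ham_path_ends[OF p] by blast
  then have a: "adj m (swap12 start2) start2" using adj_sym[OF adj_swap12] assms(1) by simp
  have s: "swap12 id \<in> perms m" using swap12_in_perms[OF id_in_perms] assms(1) by simp
  have "pair (swap12 id) \<noteq> pair start2" "pair (swap12 id) \<noteq> pair rot3" 
    by (simp_all add: pair_rot3 pair_start pair_swap12 pair_id doubleton_eq_iff)
  then have "swap12 id \<noteq> start2" "swap12 id \<noteq> swap12 start2" "swap12 id \<noteq> rot3" by (metis pair_swap12)+
  moreover have "swap12 id \<noteq> id" using swap12_neq[OF id_in_perms] .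
  ultimately show ?thesis using hc_intro[OF p a, of "swap12 id"] s by simp
qed

text \<open>Sizes 1 and 2 are served by \<open>id\<close> and its edge to \<open>rot3\<close>, sizes
  above the half by interchanging the parts.\<close>

lemma splittable_intro:
  assumes n: "4 \<le> n" and del: "deletable n"
    and half: "\<And>g l. g \<in> perms n \<Longrightarrow> g \<noteq> id \<Longrightarrow> 3 \<le> l \<Longrightarrow> l \<le> fact n div 2 \<Longrightarrow> bipartition n g l"
  shows "splittable n"
proof -
  have n3: "3 \<le> n" using n by simp
  have low: "\<exists>D\<subseteq>perms n. card D = r \<and> piece n D \<and> piece n (perms n - D) \<and> (\<exists>x\<in>D. x \<circ> h \<notin> D)"
    if h: "h \<in> perms n" "h \<noteq> id" and r: "1 \<le> r" "r \<le> fact n div 2" for h r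
  proof -
    consider "r = 1" | "r = 2" | "3 \<le> r" using r(1) by linarith
    then show ?thesis
    proof cases
      case 1
      have "piece n {id}" using id_in_perms by (auto simp: piece_def)
      moreover have "piece n (perms n - {id})"
        using hc_deleted_start1[OF n del] by (simp add: piece_def)
      ultimately show ?thesis using 1 h id_in_perms by (intro exI[of _ "{id}"]) simp
    next
      case 2
      have sub: "{id, rot3} \<subseteq> perms n" using id_in_perms rot3_in_perms n3 by simp
      have "piece n {id, rot3}"
        unfolding piece_def using adj_id_rot3[OF n3]
        by (intro disjI2 exI[of _ id] exI[of _ rot3]) (simp add: pair_id pair_rot3 doubleton_eq_iff)
      moreover have "piece n (perms n - {id, rot3})"
        using hc_deleted_start2[OF n del] by (simp add: piece_def)
      moreover have "\<exists>x\<in>{id, rot3}. x \<circ> h \<notin> {id, rot3}"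
      proof -
        have "\<exists>x\<in>perms n - {id, rot3}. x \<circ> h \<notin> perms n - {id, rot3}" using rot3_moved[OF h n3] by blast
        from not_closed_complement[OF Diff_subset h(1) this] show ?thesis
          by (simp only: double_diff[OF sub subset_refl])
      qed
      ultimately show ?thesis using 2 sub rot3_rot3 by (intro exI[of _ "{id, rot3}"]) auto
    next
      case 3
      then have "bipartition n h r" using half[OF h] r(2) by blast
      then show ?thesis unfolding bipartition_def piece_def by blast
    qed
  qed
  show ?thesis
    unfolding splittable_def
  proof (intro ballI allI impI)
    fix h r assume h: "h \<in> perms n" "h \<noteq> id" and r: "1 \<le> r" "r < (fact n :: nat)"
    show "\<exists>D\<subseteq>perms n. card D = r \<and> piece n D \<and> piece n (perms n - D) \<and> (\<exists>x\<in>D. x \<circ> h \<notin> D)"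
    proof (cases "r \<le> fact n div 2")
      case False
      then have "1 \<le> fact n - r" "fact n - r \<le> fact n div 2" using r by linarith+
      from low[OF h this] obtain D where D: "D \<subseteq> perms n" "card D = fact n - r" "piece n D" "piece n (perms n - D)"
          "\<exists>x\<in>D. x \<circ> h \<notin> D"
        by (elim exE conjE)
      have "card (perms n - D) = r"
        using D(1,2) r finite_subset[OF D(1) finite_perms] by (simp add: card_Diff_subset card_perms)
      moreover have "perms n - (perms n - D) = D" using D(1) by blast
      moreover have "\<exists>x\<in>perms n - D. x \<circ> h \<notin> perms n - D" by (rule not_closed_complement[OF D(1) h(1) D(5)])
      ultimately show ?thesis using D(3,4) by (intro exI[of _ "perms n - D"]) auto
    qed (use low[OF h r(1)] in blast)
  qed
qed

context split_star_step
begin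

lemma deletable_Suc:
  assumes "deletable m"
  shows "deletable n"
proof -
  have sub: "{id} \<subseteq> perms m" "{id, rot3} \<subseteq> perms m" "{id, swap12 id} \<subseteq> perms m"
    using id_in_perms rot3_in_perms swap12_in_perms[OF id_in_perms] n by auto
  have d: "hp m (perms m - {id}) start1 (swap12 start1)" "hp m (perms m - {id, rot3}) start2 (swap12 start2)"
      "hc m (perms m - {id, swap12 id})"
    using assms by (auto simp: deletable_def)
  have s: "start1 \<in> perms m" "start2 \<in> perms m" using ham_path_ends[OF d(1)] ham_path_ends[OF d(2)] by auto
  have "start1 \<noteq> swap12 start1" "start2 \<noteq> swap12 start2" using swap12_neq s by metis+
  then have "hp n (perms n - {id}) start1 (swap12 start1)" "hp n (perms n - {id, rot3}) start2 (swap12 start2)"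
    using hp_insert_Suc[OF d(1) _ sub(1)] hp_insert_Suc[OF d(2) _ sub(2)] by simp_all
  moreover have "hc n (perms n - {id, swap12 id})"
  proof -
    have "pair id \<noteq> pair rot3" by (simp add: pair_id pair_rot3 doubleton_eq_iff)
    then have "rot3 \<noteq> id" "rot3 \<noteq> swap12 id" by (metis pair_swap12)+
    then have r: "rot3 \<in> perms m - {id, swap12 id}" using sub(2) by simp
    \<comment> \<open>The cycle is opened at \<open>rot3\<close>, lifted as a path and closed again
      by the edge to \<open>c\<close>; \<open>d'\<close> is the third vertex for
      \<open>hc_intro\<close>.\<close>
    obtain c d' where c: "c \<noteq> d'" "hp m (perms m - {id, swap12 id}) rot3 c" "adj m rot3 c"
        "hp m (perms m - {id, swap12 id}) rot3 d'" "adj m rot3 d'"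
      by (rule ham_cycle_two_arcs[OF symp_adj d(3) r])
    have p: "hp n (perms n - {id, swap12 id}) rot3 c"
      using hp_insert_Suc[OF c(2) adj_neq[OF c(3)] sub(3)] .
    moreover have "adj n c rot3" using adj_sym[OF adj_Suc[OF c(3)]] n(1) by simp
    moreover have "d' \<in> perms n - {id, swap12 id}" using ham_path_ends[OF c(4)] in_perms_m by blast
    ultimately show ?thesis using hc_intro[of n _ rot3 c d'] c(1) adj_neq[OF c(5)] by blast
  qed
  ultimately show ?thesis by (simp add: deletable_def)
qed

lemma hc_attach_edge:
  assumes "hp m D y (swap12 y)" "D \<subseteq> perms m" "t \<in> pair y" "t \<in> {1..m}"
  shows "hc n (D \<union> {cross n y t, swap12 (cross n y t)})"
proof -
  note e = hp_attach_edge[OF assms refl]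
  have "y \<in> D" using ham_path_ends[OF assms(1)] by blast
  moreover from this have yn: "y n = n" using assms(2) in_perms_m by blast
  have "cross n y t n = t" "swap12 (cross n y t) n = t" using e(3,4) by (simp_all add: copies_def)
  then have "y \<noteq> cross n y t" "y \<noteq> swap12 (cross n y t)" using yn assms(4) n by (metis Suc_n_not_le_n atLeastAtMost_iff)+
  ultimately show ?thesis using hc_intro[OF e(1,2), of y] by blast
qed

text \<open>The copy fixing n gives up \<open>id\<close> and takes two vertices of copy 4. In the
  complement \<open>id\<close> is attached to the copies 1 and 2.\<close>

lemma bipartition_succ:
  assumes del: "deletable m" and g: "g \<in> perms n" "g \<noteq> id"
  shows "bipartition n g (fact m + 1)"
proof -
  have d: "hp m (perms m - {id}) start1 (swap12 start1)" "hc m (perms m - {id, swap12 id})"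
    using del by (auto simp: deletable_def)
  have X: "hc n (perms m - {id} \<union> {cross n start1 4, swap12 (cross n start1 4)} \<union> copies n {})"
    using hc_attach_edge[OF d(1)] n by (simp add: pair_start copies_def)
  have "bipartition n g (fact m - card {id :: nat \<Rightarrow> nat} + 2 + card ({} :: nat set) * fact m)"
  proof (rule bipartition_exchange[OF g _ _ ham_path.single _ _ _ _ _ _ d(1) _ _ refl d(2) _ X])
    show "{id} \<subseteq> {id, id}" by simp
    show "\<exists>x\<in>perms m - {id}. x \<circ> h \<in> {id}" if "h \<in> perms m" "h \<noteq> id" for h
      using singleton_moved that .
    show "(1::nat) \<in> pair id" "2 \<in> pair id" by (simp_all add: pair_id)
  qed (use n in \<open>simp_all add: pair_id pair_start id_in_perms\<close>)
  moreover have "(1::nat) \<le> fact m" by simp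
  ultimately show ?thesis by simp
qed

text \<open>Two vertices are given up and two received, so the size remains a multiple of m! while
  the set is no longer a union of copies. Copies 2 and 3 stay in the complement as exits of
  \<open>id\<close> and \<open>rot3\<close>.\<close>

lemma bipartition_multiple:
  assumes del: "deletable m" and g: "g \<in> perms n" "g \<noteq> id" and q: "1 \<le> q" "2 * q \<le> n"
  shows "bipartition n g (q * fact m)"
proof -
  let ?D = "perms m - {id, rot3}" and ?z = "cross n start2 4"
  let ?C = "?D \<union> {?z, swap12 ?z}"
  have d: "hp m ?D start2 (swap12 start2)" "hc m (perms m - {id, swap12 id})"
    using del by (auto simp: deletable_def)
  have D: "?D \<subseteq> perms m" by blast
  have t: "4 \<in> pair start2" "4 \<in> {1..m}" using n by (simp_all add: pair_start)
  note e = hp_attach_edge[OF d(1) D t refl]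
  have C0: "hc n ?C" by (rule hc_attach_edge[OF d(1) D t])
  have z: "?z \<in> perms n" "?z n = 4" "swap12 ?z \<in> perms n" "swap12 ?z n = 4" using e(3,4) by (auto simp: copies_def)
  have C: "?C \<subseteq> perms n" using z in_perms_m by blast
  have last: "x n = n \<or> x n = 4" if "x \<in> ?C" for x using that z in_perms_m by blast
  have disj: "?C \<inter> copies n X = {}" if "X \<subseteq> {1..m} - {4}" for X
  proof -
    have "x n \<notin> X" if "x \<in> ?C" for x using last[OF that] \<open>X \<subseteq> _\<close> n by auto
    then show ?thesis by (auto simp: copies_def)
  qed
  have "\<exists>X\<subseteq>{1..m} - {4, 2, 3}. card X = q - 1 \<and> hc n (?C \<union> copies n X)"
  proof -
    consider "q = 1" | "q = 2" | "3 \<le> q" using q(1) by linarith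
    then show ?thesis
    proof cases
      case 1
      then show ?thesis using C0 by (intro exI[of _ "{}"]) (simp add: copies_def)
    next
      case 2
      have s2: "start2 \<in> perms n" using ham_path_ends[OF d(1)] in_perms_m by blast
      \<comment> \<open>Leaving \<open>start2\<close> through its symbol 4 keeps its symbol 1, so
        both ends of the attached edge reach copy 1.\<close>
      have "1 \<in> pair ?z" using pair_cross[OF s2 t(1)] n by (simp add: pair_start)
      then have p1: "1 \<in> pair ?z" "1 \<in> pair (swap12 ?z)" by (simp_all add: pair_swap12)
      have neq: "cross n ?z 1 \<noteq> cross n (swap12 ?z) 1"
      proof
        assume eq: "cross n ?z 1 = cross n (swap12 ?z) 1"
        have "?z \<noteq> swap12 ?z" using swap12_neq[OF z(1)] by metis
        then show False using cross_collision(1)[OF z(1,3) _ p1 eq] z(2,4) n by simp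
      qed
      have sub: "{1} \<subseteq> {1..n}" using n by auto
      have "hc n (?C \<union> copies n {1})"
        by (rule hc_extend[OF e(1) disj C sub _ _ _ p1 neq]) (use n in auto)
      then show ?thesis using 2 n by (intro exI[of _ "{1}"]) auto
    next
      case 3
      \<comment> \<open>With q at least 3 the bound on q makes 5 a copy name, so 1 and 5 can be two
        different exits.\<close>
      then have m5: "5 \<le> m" using q(2) n by linarith
      have "card {1, 5::nat} \<le> q - 1" using 3 by simp
      moreover have "q - 1 \<le> card ({1..m} - {4, 2, 3})"
        using q(2) m5 n by (simp add: card_Diff_subset)
      ultimately obtain X where X: "{1, 5} \<subseteq> X" "X \<subseteq> {1..m} - {4, 2, 3}" "card X = q - 1"
        using exists_subset_between[of "{1, 5}" "q - 1" "{1..m} - {4, 2, 3}"] m5 by auto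
      obtain x where x: "x \<in> perms m" "x 1 = 1" "x 2 = 5" using perm_exists2[of 1 m 2 1 5] m5 by auto
      then have px: "pair x = {1, 5}" by (simp add: pair_def)
      then have "x \<in> ?C" using x(1) pair_id pair_rot3 by (auto simp: doubleton_eq_iff)
      then obtain y where y: "hp n ?C x y" "adj n x y" "pair x \<noteq> pair y" by (rule hc_arc[OF C0])
      obtain u v where uv: "hp n ?C u v" "adj n v u" "1 \<in> pair u" "5 \<in> pair v" "{u, v} = {x, y}"
        by (rule arc_choice[OF y, of 1 5]) (use px in auto)
      have "cross n u 1 n = 1" "cross n v 5 n = 5" using cross_last uv(3,4) n by simp_all
      then have neq: "cross n u 1 \<noteq> cross n v 5" by auto
      have Xn: "X \<subseteq> {1..n}" using X(2) n by auto
      have "hc n (?C \<union> copies n X)"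
        by (rule hc_extend[OF uv(1) disj C Xn _ _ _ uv(3,4) neq]) (use X in auto)
      then show ?thesis using X by blast
    qed
  qed
  then obtain X where X: "X \<subseteq> {1..m} - {4, 2, 3}" "card X = q - 1" "hc n (?C \<union> copies n X)" by blast
  have P: "hp m {id, rot3} id rot3"
    using hp_cons[OF ham_path.single adj_id_rot3, of m] rot3_rot3 n by auto
  have *: "bipartition n g (fact m - card {id, rot3} + 2 + card X * fact m)"
  proof (rule bipartition_exchange[where i = id and j = rot3, OF g _ _ P _ _ _ _ _ _ d(1) t refl d(2) X(1,3)])
    show "\<exists>x\<in>perms m - {id, rot3}. x \<circ> h \<in> {id, rot3}" if "h \<in> perms m" "h \<noteq> id" for h
      using rot3_moved[OF that] n by simp
    show "{id, rot3} \<subseteq> perms m" using id_in_perms rot3_in_perms n by simp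
  qed (simp_all add: pair_id pair_rot3)
  have "(2::nat) \<le> fact m" using fact_ge_self[of m] n by linarith
  moreover have "card {id, rot3} = 2" using rot3_rot3 by simp
  moreover have "fact m + (q - 1) * fact m = q * fact m" using q(1) by (cases q) simp_all
  moreover have "card X * fact m = (q - 1) * fact m" by (simp only: X(2))
  ultimately have "fact m - card {id, rot3} + 2 + card X * fact m = q * fact m" by linarith
  with * show ?thesis by (simp only:)
qed

lemma bipartition_half:
  assumes sp: "splittable m" and del: "deletable m" and g: "g \<in> perms n" "g \<noteq> id"
    and l: "3 \<le> l" "l \<le> fact n div 2"
  shows "bipartition n g l"
proof (cases "l < fact m")
  case True
  then show ?thesis using bipartition_small[OF sp g l(1)] by simp
next
  case False
  define q r where "q = l div fact m" and "r = l mod fact m"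
  have lqr: "l = q * fact m + r" and r: "r < fact m" by (simp_all add: q_def r_def)
  have q1: "1 \<le> q" using False lqr r by (cases q) auto
  have "2 * l \<le> n * fact m" using l(2) n(1) by simp
  then have q2: "2 * q * fact m + 2 * r \<le> n * fact m" using lqr by simp
  have qn: "2 * q \<le> n"
  proof -
    have "2 * q * fact m \<le> n * fact m" using q2 by linarith
    then show ?thesis by simp
  qed
  show ?thesis
  proof (cases "r = 0")
    case True
    then show ?thesis using bipartition_multiple[OF del g q1 qn] lqr by simp
  next
    case False
    show ?thesis
    proof (cases "q = 1 \<and> r = 1")
      case True
      then show ?thesis using bipartition_succ[OF del g] lqr by simp
    next
      case qr: False
      \<comment> \<open>An integer q with 2q at most m + 1 is at most m - 2 once m is at least
        4.\<close>
      have "q \<le> m - 2" using qn n by linarith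
      then have "bipartition n g (r + q * fact m)"
        using qr False r by (intro bipartition_main[OF sp g q1]) auto
      then show ?thesis using lqr by (simp add: add.commute)
    qed
  qed
qed

lemma splittable_Suc: "splittable m \<Longrightarrow> deletable m \<Longrightarrow> splittable n"
  using splittable_intro[of n] deletable_Suc bipartition_half n by simp

end

lemma two_dcc_of_splittable:
  assumes n: "4 \<le> n" and sp: "splittable n"
  shows "two_dcc_vertex_pancyclic (split_star n) 3 (fact n div 2)"
  unfolding two_dcc_vertex_pancyclic_def
proof (intro ballI impI)
  fix l :: nat and u v
  assume l: "l \<in> {3..fact n div 2}" and "u \<in> pverts (split_star n)" "v \<in> pverts (split_star n)" and uv: "u \<noteq> v"
  have pv: "pverts (split_star n) = perms n" by (simp add: split_star_def perms_def)
  then have u: "u \<in> perms n" and v: "v \<in> perms n" using \<open>u \<in> _\<close> \<open>v \<in> _\<close> by simp_all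
  let ?g = "inv u \<circ> v"
  have ug: "u \<circ> ?g = v" using perms_inv_comp(1)[OF u] by (simp add: o_assoc)
  have g: "?g \<in> perms n" "?g \<noteq> id" using perms_comp[OF perms_inv[OF u] v] ug uv by auto
  \<comment> \<open>Since \<open>l\<close> is at most half of n!, the complement has three vertices
    too, and neither piece is degenerate.\<close>
  have "l < fact n" "3 \<le> l" "3 \<le> fact n - l" using l by auto
  then have "1 \<le> l" by simp
  from sp[unfolded splittable_def, rule_format, OF g this \<open>l < fact n\<close>]
  obtain D where D: "D \<subseteq> perms n" "card D = l" "piece n D" "piece n (perms n - D)" "\<exists>x\<in>D. x \<circ> ?g \<notin> D"
    by (elim exE conjE)
  obtain x where x: "x \<in> D" "x \<circ> ?g \<notin> D" using D(5) by blast
  have xp: "x \<in> perms n" using x D(1) by blast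
  let ?s = "u \<circ> inv x"
  let ?f = "\<lambda>S. (\<circ>) ?s ` S"
  have s: "?s \<in> perms n" using perms_comp[OF u perms_inv[OF xp]] .
  have su: "?s \<circ> x = u" using perms_inv_comp(2)[OF xp] by (simp add: comp_assoc)
  have sv: "?s \<circ> (x \<circ> ?g) = v" using su ug by (simp add: o_assoc)
  have cE: "card (perms n - D) = fact n - l"
    using D(1,2) finite_subset[OF D(1) finite_perms] by (simp add: card_Diff_subset card_perms)
  have "hc n D" "hc n (perms n - D)" using piece_hc D(2,3,4) cE \<open>3 \<le> l\<close> \<open>3 \<le> fact n - l\<close> by simp_all
  then have hcs: "hc n (?f D)" "hc n (?f (perms n - D))" using hc_left s by blast+
  have inj: "inj_on ((\<circ>) ?s) UNIV" by (rule inj_on_left[OF s])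
  have sub: "?f S \<subseteq> perms n" if "S \<subseteq> perms n" for S using that perms_comp[OF s] by blast
  have arcs: "(x, y) \<in> parcs (split_star n)" if "adj n x y" for x y
    using that adj_neq[OF that] by (auto simp: split_star_def adj_def perms_def)
  obtain C1 where C1: "graph_cycle (split_star n) C1" "cycle_verts C1 = ?f D" "length C1 = card (?f D)"
    using graph_cycle_of_ham_cycle[OF hcs(1), of "split_star n"] arcs sub[OF D(1)] pv by metis
  obtain C2 where C2: "graph_cycle (split_star n) C2" "cycle_verts C2 = ?f (perms n - D)"
      "length C2 = card (?f (perms n - D))"
    using graph_cycle_of_ham_cycle[OF hcs(2), of "split_star n"] arcs sub[of "perms n - D"] pv by (metis Diff_subset)
  have "length C1 = l" using C1(3) D(2) card_image[OF inj_on_left[OF s], of D] by argo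
  moreover have "length C2 = card (pverts (split_star n)) - l"
    using C2(3) cE card_image[OF inj_on_left[OF s], of "perms n - D"] card_pverts_split_star[of n] by argo
  moreover have "cycle_verts C1 \<inter> cycle_verts C2 = {}"
    unfolding C1(2) C2(2) using inj by (auto simp: inj_on_def)
  moreover have "u \<in> cycle_verts C1" unfolding C1(2) using x(1) su by (metis imageI)
  moreover have "v \<in> cycle_verts C2"
    unfolding C2(2) using x(2) perms_comp[OF xp g(1)] sv by (metis DiffI imageI)
  ultimately show "\<exists>C1 C2. graph_cycle (split_star n) C1 \<and> graph_cycle (split_star n) C2 \<and>
      cycle_verts C1 \<inter> cycle_verts C2 = {} \<and> u \<in> cycle_verts C1 \<and> v \<in> cycle_verts C2 \<and>
      (length C1 = l \<and> length C2 = card (pverts (split_star n)) - l \<or>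
       length C1 = card (pverts (split_star n)) - l \<and> length C2 = l)"
    using C1(1) C2(1) by blast
qed

section \<open>Dimension four\<close>

type_synonym quad = "nat \<times> nat \<times> nat \<times> nat"

fun perm_of :: "quad \<Rightarrow> nat \<Rightarrow> nat" where
  "perm_of (a, b, c, d) = id(1 := a, 2 := b, 3 := c, 4 := d)"

text \<open>Move 0 is an edge of type (i), moves 1 and 2 are types (ii) and (iii) with i = 3, moves
  3 and 4 the same with i = 4.\<close>

fun step :: "nat \<Rightarrow> quad \<Rightarrow> quad" where
  "step k (a, b, c, d) =
     (if k = 0 then (b, a, c, d) else if k = 1 then (b, c, a, d) else if k = 2 then (c, a, b, d)
      else if k = 3 then (b, d, c, a) else (d, a, c, b))"

fun walk :: "quad \<Rightarrow> nat list \<Rightarrow> quad list" where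
  "walk t [] = [t]"
| "walk t (k # ks) = t # walk (step k t) ks"

definition base :: quad where "base = (1, 2, 3, 4)"

abbreviation target :: "nat list \<Rightarrow> quad" where "target w \<equiv> last (walk base w)"

fun nth_quad :: "quad \<Rightarrow> nat \<Rightarrow> nat" where
  "nth_quad (a, b, c, d) i = (if i = 1 then a else if i = 2 then b else if i = 3 then c else d)"

fun comp_quad :: "quad \<Rightarrow> quad \<Rightarrow> quad" where
  "comp_quad t (p, q, r, s) = (nth_quad t p, nth_quad t q, nth_quad t r, nth_quad t s)"

definition closes :: "quad list \<Rightarrow> bool" where
  "closes p \<longleftrightarrow> list_ex (\<lambda>k. step k (last p) = hd p) [0, 1, 2, 3, 4]"

text \<open>\<open>u\<close> serves only to name the start of the second cycle. With 24 distinct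
  strings the two walks exhaust the network.\<close>

definition two_cycles :: "nat list \<Rightarrow> nat list \<Rightarrow> nat list \<Rightarrow> bool" where
  "two_cycles v u w \<longleftrightarrow> 3 \<le> length (walk base v) \<and> 3 \<le> length (walk (target u) w) \<and>
     (let p = walk base v; q = walk (target u) w in
      length (p @ q) = 24 \<and> distinct (p @ q) \<and> closes p \<and> closes q)"

(* A set containing the identity can only be closed under right multiplication by one of its elements. *)
definition rigid :: "quad list \<Rightarrow> bool" where
  "rigid p \<longleftrightarrow> list_all (\<lambda>t. t = base \<or> list_ex (\<lambda>x. comp_quad x t \<notin> set p) p) p"

lemma perm_of_inj: "perm_of s = perm_of t \<longleftrightarrow> s = t"
proof
  assume eq: "perm_of s = perm_of t"
  obtain a b c d a' b' c' d' where st: "s = (a, b, c, d)" "t = (a', b', c', d')" by (cases s, cases t)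
  have "perm_of s i = perm_of t i" for i using eq by simp
  from this[of 1] this[of 2] this[of 3] this[of 4] show "s = t" by (simp add: st)
qed simp

lemma perm_of_base: "perm_of base = id"
  by (auto simp: base_def)

declare perm_of.simps [simp del]

text \<open>A move rearranges positions, so it is right multiplication by a fixed
  permutation.\<close>

lemma adj_step:
  assumes "perm_of t \<in> perms 4"
  shows "adj 4 (perm_of t) (perm_of (step k t))"
proof -
  obtain a b c d where t: "t = (a, b, c, d)" by (cases t)
  let ?\<pi> = "if k = 0 then transpose 1 2 else if k = 1 then transpose 1 2 \<circ> transpose 2 3
    else if k = 2 then transpose 1 2 \<circ> transpose 1 3 else if k = 3 then transpose 1 2 \<circ> transpose 2 4
    else transpose 1 2 \<circ> transpose 1 (4 :: nat)"
  have "perm_of (step k t) = perm_of t \<circ> ?\<pi>"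
    by (rule ext) (auto simp: t transpose_def perm_of.simps)
  moreover have "?\<pi> \<in> perms 4" by (auto intro!: perms_comp perms_transpose)
  ultimately have "perm_of (step k t) \<in> perms 4" using perms_comp[OF assms] by (simp only:)
  moreover have "{3..4::nat} = {3, 4}" by auto
  then have "split_star_adj 4 (perm_of t) (perm_of (step k t))"
    unfolding split_star_adj_def by (auto simp: t perm_of.simps)
  ultimately show ?thesis using assms by (simp add: adj_def)
qed

lemma hd_walk: "walk t ks \<noteq> [] \<and> hd (walk t ks) = t"
  by (cases ks) auto

lemma walk_adj:
  "perm_of t \<in> perms 4 \<Longrightarrow>
   successively (adj 4) (map perm_of (walk t ks)) \<and> perm_of ` set (walk t ks) \<subseteq> perms 4"
proof (induction t ks rule: walk.induct)
  case (2 t k ks)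
  have a: "adj 4 (perm_of t) (perm_of (step k t))" by (rule adj_step[OF 2(2)])
  then have "perm_of (step k t) \<in> perms 4" by (simp add: adj_def)
  then have IH: "successively (adj 4) (map perm_of (walk (step k t) ks))" "perm_of ` set (walk (step k t) ks) \<subseteq> perms 4"
    using 2(1) by blast+
  have "hd (map perm_of (walk (step k t) ks)) = perm_of (step k t)" using hd_walk[of "step k t" ks] by (simp add: hd_map)
  then show ?case using IH a 2(2) hd_walk[of "step k t" ks] by (simp add: successively_Cons)
qed simp

lemma target_in_perms: "perm_of (target w) \<in> perms 4"
  using walk_adj[of base w] hd_walk[of base w] last_in_set[of "walk base w"] by (auto simp: perm_of_base id_in_perms)

lemma hp_walk:
  assumes "perm_of t \<in> perms 4" "distinct (walk t ks)"
  shows "hp 4 (perm_of ` set (walk t ks)) (perm_of t) (perm_of (last (walk t ks)))"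
  unfolding ham_path_iff_list
  using walk_adj[OF assms(1), of ks] assms(2) hd_walk[of t ks]
  by (intro exI[of _ "map perm_of (walk t ks)"]) (auto simp: distinct_map inj_on_def perm_of_inj hd_map last_map)

lemma perms4_eq:
  assumes "distinct (p @ q)" "length (p @ q) = 24" "perm_of ` set (p @ q) \<subseteq> perms 4"
  shows "perm_of ` set p = perms 4 - perm_of ` set q"
proof -
  have inj: "inj perm_of" by (simp add: inj_on_def perm_of_inj)
  have "card (perm_of ` set (p @ q)) = 24"
    using assms(1,2) distinct_card[OF assms(1)] card_image[OF inj_on_subset[OF inj]] by simp
  then have "perm_of ` set (p @ q) = perms 4"
    using assms(3) finite_perms by (intro card_subset_eq) (simp_all add: card_perms fact_numeral)
  moreover have "perm_of ` set p \<inter> perm_of ` set q = {}" using assms(1) by (auto simp: perm_of_inj)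
  ultimately show ?thesis by auto
qed

lemma hp_walk_complement:
  assumes "distinct (walk (target u) w @ q)" "length (walk (target u) w @ q) = 24" "perm_of ` set q \<subseteq> perms 4"
  shows "hp 4 (perms 4 - perm_of ` set q) (perm_of (target u)) (perm_of (last (walk (target u) w)))"
  using perms4_eq[OF assms(1,2)] hp_walk[OF target_in_perms, of u w] walk_adj[OF target_in_perms, of u w] assms(1,3)
  by (simp add: image_Un)

text \<open>Hamiltonian paths from the identity, one to each of the other 23 vertices.\<close>

definition connecting_words :: "nat list list" where
  "connecting_words =
   [[0, 1, 0, 2, 0, 3, 0, 2, 0, 4, 0, 2, 0, 1, 0, 3, 3, 1, 1, 0, 1, 1, 3],
    [0, 2, 0, 1, 3, 1, 0, 1, 1, 0, 3, 1, 0, 1, 1, 0, 4, 0, 1, 0, 2, 0, 4],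
    [0, 1, 0, 2, 0, 3, 0, 2, 0, 1, 0, 4, 2, 0, 2, 2, 0, 3, 0, 2, 2, 0, 2],
    [0, 1, 0, 2, 0, 3, 0, 4, 0, 2, 0, 1, 0, 3, 0, 4, 0, 2, 0, 1, 0, 3, 0],
    [0, 1, 0, 2, 0, 3, 0, 2, 0, 1, 0, 3, 1, 0, 1, 4, 0, 2, 0, 1, 0, 3, 0],
    [1, 1, 0, 1, 3, 0, 2, 0, 1, 0, 3, 1, 0, 1, 1, 0, 4, 1, 1, 0, 1, 1, 3],
    [0, 1, 0, 2, 0, 3, 0, 2, 0, 1, 3, 1, 0, 1, 1, 0, 4, 0, 2, 0, 1, 0, 4],
    [0, 1, 0, 3, 0, 4, 0, 2, 0, 1, 0, 3, 0, 1, 0, 4, 1, 1, 0, 1, 1, 3, 0],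
    [0, 1, 0, 2, 0, 3, 0, 2, 0, 1, 0, 3, 1, 0, 1, 1, 0, 4, 0, 2, 0, 1, 0],
    [0, 1, 0, 2, 0, 4, 0, 1, 0, 2, 0, 3, 1, 0, 1, 1, 0, 4, 0, 1, 0, 2, 0],
    [0, 1, 0, 2, 0, 3, 0, 2, 0, 1, 0, 3, 1, 0, 1, 4, 0, 2, 0, 1, 4, 0, 4],
    [0, 1, 1, 0, 3, 0, 2, 0, 1, 0, 3, 1, 0, 1, 1, 0, 4, 1, 1, 0, 1, 1, 3],
    [0, 1, 0, 2, 0, 3, 0, 2, 0, 1, 0, 3, 1, 0, 2, 0, 4, 0, 2, 0, 1, 0, 3],
    [0, 1, 0, 2, 3, 1, 0, 1, 1, 0, 3, 1, 0, 1, 1, 0, 4, 0, 1, 0, 2, 0, 4],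
    [0, 1, 0, 2, 0, 3, 0, 2, 0, 1, 0, 3, 1, 0, 1, 1, 0, 4, 0, 1, 1, 0, 1],
    [0, 1, 0, 2, 0, 3, 0, 2, 0, 1, 0, 3, 0, 2, 2, 3, 1, 1, 0, 1, 1, 3, 2],
    [0, 1, 0, 2, 0, 3, 0, 2, 0, 1, 0, 3, 1, 0, 1, 1, 0, 4, 0, 1, 0, 2, 0],
    [0, 1, 0, 2, 0, 3, 0, 2, 2, 0, 3, 0, 2, 2, 3, 1, 1, 0, 1, 1, 3, 2, 3],
    [0, 1, 0, 2, 0, 3, 0, 2, 0, 1, 0, 3, 1, 0, 1, 1, 3, 1, 1, 0, 1, 1, 3],
    [0, 1, 0, 2, 0, 3, 1, 0, 3, 0, 1, 0, 2, 0, 4, 0, 3, 0, 2, 2, 0, 2, 3],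
    [0, 1, 0, 2, 0, 3, 0, 2, 0, 1, 0, 3, 1, 0, 1, 1, 0, 4, 1, 1, 0, 1, 1],
    [0, 1, 0, 2, 0, 3, 0, 2, 0, 1, 0, 3, 1, 1, 0, 3, 0, 2, 2, 0, 2, 3, 2],
    [0, 1, 0, 2, 0, 3, 0, 2, 0, 1, 0, 3, 1, 0, 1, 1, 0, 4, 0, 2, 2, 0, 2]]"

text \<open>Triples for \<open>two_cycles\<close>. The closing edge is not spelled out, so the first
  word has one letter fewer than its cycle has vertices.\<close>

definition cycle_words :: "(nat list \<times> nat list \<times> nat list) list" where
  "cycle_words =
   [([3, 3],
     [0, 1, 4, 1],
     [1, 1, 0, 1, 3, 1, 4, 0, 4, 1, 1, 4, 1, 3, 1, 1, 0, 2, 3, 3]),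
    ([1, 1],
     [0, 1, 4, 1],
     [1, 0, 2, 0, 3, 1, 1, 3, 1, 0, 1, 1, 0, 4, 1, 1, 0, 1, 1, 3]),
    ([3, 1, 3],
     [0, 1, 4, 1],
     [1, 1, 0, 1, 3, 0, 2, 2, 4, 2, 2, 3, 1, 1, 0, 1, 1, 3, 3]),
    ([4, 2, 3, 3],
     [0, 1, 4, 1],
     [1, 1, 0, 4, 0, 1, 1, 3, 1, 1, 4, 1, 1, 0, 1, 1, 4, 4]),
    ([4, 4, 1, 3, 2],
     [0, 1, 4, 1],
     [1, 0, 2, 0, 3, 1, 1, 3, 3, 2, 2, 3, 2, 0, 2, 3, 3]),
    ([2, 3, 1, 3, 0, 1],
     [0, 1, 4, 1],
     [1, 1, 3, 3, 0, 2, 0, 1, 3, 1, 1, 0, 1, 1, 3, 3]),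
    ([4, 1, 1, 3, 3, 0, 1],
     [0, 1, 4, 1],
     [1, 3, 1, 1, 3, 0, 2, 0, 1, 0, 3, 0, 4, 0, 2]),
    ([3, 0, 2, 3, 3, 2, 2, 0],
     [0, 1, 4, 1],
     [1, 0, 2, 4, 4, 1, 0, 3, 1, 1, 0, 1, 1, 4]),
    ([2, 4, 4, 0, 4, 2, 3, 1, 0],
     [0, 1, 4, 1],
     [1, 3, 0, 2, 3, 1, 0, 3, 1, 1, 0, 4, 1]),
    ([0, 4, 4, 2, 3, 3, 0, 1, 1, 3],
     [0, 1],
     [3, 3, 0, 2, 3, 2, 2, 0, 4, 0, 3, 0]),
    ([1, 4, 2, 4, 0, 2, 2, 3, 3, 0, 1],
     [0, 1, 4, 1],
     [2, 4, 0, 2, 0, 4, 2, 4, 0, 4, 4])]"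


lemma connecting_words_ok:
  "list_all (\<lambda>w. distinct (walk base w) \<and> length (walk base w) = 24) connecting_words"
  "distinct (map target connecting_words @ [base])" "length connecting_words = 23"
  by code_simp+

text \<open>Translation by \<open>x\<close> reduces an arbitrary start to the identity.\<close>

lemma ham_connected_4: "ham_connected 4"
  unfolding ham_connected_def
proof (intro ballI impI)
  fix x y assume x: "x \<in> perms 4" and y: "y \<in> perms 4" and "x \<noteq> y"
  have y': "y = x \<circ> (inv x \<circ> y)" using perms_inv_comp(1)[OF x] by (simp add: o_assoc)
  have "inv x \<circ> y \<noteq> id" using y' \<open>x \<noteq> y\<close> by auto
  then have "inv x \<circ> y \<in> perms 4 - perm_of ` set [base]" using perms_comp[OF perms_inv[OF x] y] by (simp add: perm_of_base)
  moreover have "perm_of ` set (map target connecting_words @ [base]) \<subseteq> perms 4"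
    using target_in_perms by (auto simp: perm_of_base id_in_perms)
  then have "perm_of ` set (map target connecting_words) = perms 4 - perm_of ` set [base]"
    using connecting_words_ok(2,3) by (intro perms4_eq) simp_all
  ultimately obtain w where w: "w \<in> set connecting_words" "inv x \<circ> y = perm_of (target w)" by auto
  have d: "distinct (walk base w)" "length (walk base w) = 24" using connecting_words_ok(1) w(1) by (auto simp: list_all_iff)
  have "target [] = base" by simp
  then have "hp 4 (perms 4) id (inv x \<circ> y)"
    using hp_walk_complement[of "[]" w "[]"] d w(2) by (simp add: perm_of_base)
  moreover have "(\<circ>) x ` perms 4 = perms 4"
    using copies_left[OF x, of "{1..4}"] copies_all[of 4] x by (simp add: perms_def permutes_image)
  ultimately show "hp 4 (perms 4) x y" using hp_left[of 4 "perms 4" id "inv x \<circ> y" x] x y' by simp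
qed

lemma cycle_words_ok: "list_all (\<lambda>(v, u, w). two_cycles v u w) cycle_words"
  by code_simp

(* A triangle is closed under right multiplication by a 3-cycle, so length 3 needs two triangles. *)
lemma rigid_cycle_words:
  "list_all (\<lambda>(v, u, w). rigid (walk base v)) (drop 2 cycle_words)"
  "map (\<lambda>(v, u, w). length (walk base v)) cycle_words = [3, 3, 4, 5, 6, 7, 8, 9, 10, 11, 12]"
  "set (walk base (fst (cycle_words ! 0))) \<inter> set (walk base (fst (cycle_words ! 1))) = {base}"
  by code_simp+

lemma adj_closes:
  assumes "perm_of t \<in> perms 4" "closes (walk t ks)"
  shows "adj 4 (perm_of (last (walk t ks))) (perm_of t)"
proof -
  obtain k where "step k (last (walk t ks)) = t"
    using assms(2) hd_walk[of t ks] by (auto simp: closes_def)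
  moreover have "perm_of (last (walk t ks)) \<in> perms 4"
    using walk_adj[OF assms(1), of ks] hd_walk[of t ks] last_in_set by blast
  ultimately show ?thesis using adj_step by metis
qed

lemma two_cycles_hc:
  assumes "two_cycles v u w"
  defines "C \<equiv> perm_of ` set (walk base v)"
  shows "C \<subseteq> perms 4" "card C = length (walk base v)" "hc 4 C" "hc 4 (perms 4 - C)"
proof -
  let ?p = "walk base v" and ?q = "walk (target u) w"
  have *: "3 \<le> length ?p" "3 \<le> length ?q" "length (?p @ ?q) = 24" "distinct (?p @ ?q)" "closes ?p" "closes ?q"
    using assms(1) unfolding two_cycles_def Let_def by blast+
  have b: "perm_of base \<in> perms 4" by (simp add: perm_of_base id_in_perms)
  have inj: "inj perm_of" by (simp add: inj_on_def perm_of_inj)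
  have card: "card (perm_of ` set p) = length p" if "distinct p" for p
    using card_image[OF inj_on_subset[OF inj], of "set p"] distinct_card[OF that] by simp
  show sub: "C \<subseteq> perms 4" using walk_adj[OF b, of v] by (simp add: C_def)
  show "card C = length ?p" using card[of ?p] *(4) by (simp add: C_def)
  then show "hc 4 C"
    using hp_walk[OF b, of v] adj_closes[OF b *(5)] *(1,4) unfolding ham_cycle_def C_def by auto
  have "perm_of ` set ?q = perms 4 - C"
    unfolding C_def using *(3,4) sub walk_adj[OF target_in_perms, of u w]
    by (intro perms4_eq) (auto simp: C_def image_Un)
  moreover have "hc 4 (perm_of ` set ?q)"
    using hp_walk[OF target_in_perms, of u w] adj_closes[OF target_in_perms *(6)] card[of ?q] *(2,4)
    unfolding ham_cycle_def by auto
  ultimately show "hc 4 (perms 4 - C)" by simp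
qed

lemma perm_of_comp:
  assumes "perm_of s \<in> perms 4" "perm_of t \<in> perms 4"
  shows "perm_of (comp_quad s t) = perm_of s \<circ> perm_of t"
proof -
  obtain a b c d p q r e where st: "s = (a, b, c, d)" "t = (p, q, r, e)" by (cases s, cases t)
  have nth: "nth_quad s i = perm_of s i" if "i \<in> {1..4}" for i
    using that by (auto simp: st perm_of.simps)
  have "perm_of t i \<in> {1..4}" if "i \<in> {1..4}" for i using perms_range[OF assms(2)] that by blast
  from this[of 1] this[of 2] this[of 3] this[of 4]
  have range: "p \<in> {1..4}" "q \<in> {1..4}" "r \<in> {1..4}" "e \<in> {1..4}" by (simp_all add: st perm_of.simps)
  have c: "comp_quad s t = (perm_of s p, perm_of s q, perm_of s r, perm_of s e)"
    using range by (simp only: st(2) comp_quad.simps nth)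
  show ?thesis
  proof
    fix i :: nat
    consider "i = 1" | "i = 2" | "i = 3" | "i = 4" | "i \<notin> {1..4}" by force
    then show "perm_of (comp_quad s t) i = (perm_of s \<circ> perm_of t) i"
    proof cases
      case 5
      then have "i \<noteq> 1" "i \<noteq> 2" "i \<noteq> 3" "i \<noteq> 4" by auto
      moreover from 5 have "perm_of t i = i" "perm_of s i = i" using perms_outside assms by blast+
      ultimately show ?thesis unfolding c by (simp add: perm_of.simps)
    qed (unfold c, simp_all add: st(2) perm_of.simps)
  qed
qed

text \<open>If \<open>g\<close> is outside the set, the identity is moved out; otherwise
  \<open>rigid\<close> supplies a vertex that is.\<close>

lemma rigid_moved:
  assumes "rigid (walk base v)" "g \<noteq> id"
  shows "\<exists>x\<in>perm_of ` set (walk base v). x \<circ> g \<notin> perm_of ` set (walk base v)"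
proof (cases "g \<in> perm_of ` set (walk base v)")
  case True
  let ?p = "walk base v"
  have sub: "perm_of ` set ?p \<subseteq> perms 4" using walk_adj[of base v] by (simp add: perm_of_base id_in_perms)
  obtain t where t: "t \<in> set ?p" "g = perm_of t" using True by blast
  have "t \<noteq> base" using t(2) assms(2) perm_of_base by auto
  then obtain x where x: "x \<in> set ?p" "comp_quad x t \<notin> set ?p"
    using assms(1) t(1) by (auto simp: rigid_def list_all_iff list_ex_iff)
  have "perm_of x \<circ> g = perm_of (comp_quad x t)" using perm_of_comp[of x t] subsetD[OF sub] x(1) t by simp
  then have "perm_of x \<circ> g \<notin> perm_of ` set ?p" using x(2) by (auto simp: perm_of_inj)
  then show ?thesis using x(1) by blast
next
  case False
  moreover have "id \<in> perm_of ` set (walk base v)"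
    using hd_walk[of base v] hd_in_set perm_of_base by (metis imageI)
  ultimately show ?thesis by force
qed

lemma bipartition_4:
  assumes g: "g \<in> perms 4" "g \<noteq> id" and l: "3 \<le> l" "l \<le> 12"
  shows "bipartition 4 g l"
proof -
  have len: "length cycle_words = 11" using arg_cong[OF rigid_cycle_words(2), of length] by simp
  have nth: "bipartition 4 g (length (walk base (fst (cycle_words ! i))))"
    if i: "i < 11" and moved: "\<exists>x\<in>perm_of ` set (walk base (fst (cycle_words ! i))).
      x \<circ> g \<notin> perm_of ` set (walk base (fst (cycle_words ! i)))" for i
  proof -
    obtain v u w where c: "cycle_words ! i = (v, u, w)" by (cases "cycle_words ! i")
    have "(v, u, w) \<in> set cycle_words" using i len c nth_mem by metis
    then have "two_cycles v u w" using cycle_words_ok by (auto simp: list_all_iff)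
    from two_cycles_hc[OF this] show ?thesis using moved unfolding bipartition_def c fst_conv by blast
  qed
  have length: "length (walk base (fst (cycle_words ! i))) = [3, 3, 4, 5, 6, 7, 8, 9, 10, 11, 12] ! i" if "i < 11" for i
  proof -
    have "length (walk base (fst (cycle_words ! i))) = map (\<lambda>(v, u, w). length (walk base v)) cycle_words ! i"
      using that len by (simp add: case_prod_beta)
    then show ?thesis unfolding rigid_cycle_words(2) .
  qed
  show ?thesis
  proof (cases "l = 3")
    case True
    let ?C = "\<lambda>i. perm_of ` set (walk base (fst (cycle_words ! i)))"
    have "id \<in> ?C i" for i using hd_walk[of base] hd_in_set perm_of_base by (metis imageI)
    \<comment> \<open>The two triangles share only the identity, so one of them lacks
      \<open>g\<close>, and \<open>id \<circ> g\<close> leaves that one.\<close>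
    moreover have "g \<notin> ?C 0 \<or> g \<notin> ?C 1"
    proof (rule ccontr)
      assume "\<not> ?thesis"
      then obtain s t where st: "s \<in> set (walk base (fst (cycle_words ! 0)))" "t \<in> set (walk base (fst (cycle_words ! 1)))"
          "g = perm_of s" "g = perm_of t"
        by blast
      have "s = t" using trans[OF st(3)[symmetric] st(4)] by (simp only: perm_of_inj)
      have "s \<in> set (walk base (fst (cycle_words ! 0))) \<inter> set (walk base (fst (cycle_words ! 1)))"
        by (rule IntI) (rule st(1), unfold \<open>s = t\<close>, rule st(2))
      then have "s \<in> {base}" by (simp only: rigid_cycle_words(3))
      then show False using g(2) perm_of_base st(3) by simp
    qed
    ultimately have "(\<exists>x\<in>?C 0. x \<circ> g \<notin> ?C 0) \<or> (\<exists>x\<in>?C 1. x \<circ> g \<notin> ?C 1)" by (metis comp_id id_comp)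
    then show ?thesis using nth[of 0] nth[of 1] length[of 0] length[of 1] True by auto
  next
    case False
    \<comment> \<open>Length 3 occupies the entries 0 and 1, so a larger length \<open>l\<close> has
      index \<open>l - 2\<close>.\<close>
    define i where "i = l - 2"
    have i: "2 \<le> i" "i < 11" using False l by (auto simp: i_def)
    obtain v u w where c: "cycle_words ! i = (v, u, w)" by (cases "cycle_words ! i")
    have "drop 2 cycle_words ! (i - 2) = cycle_words ! (2 + (i - 2))" using i len by (intro nth_drop) simp
    then have "drop 2 cycle_words ! (i - 2) = (v, u, w)" "i - 2 < length (drop 2 cycle_words)"
      using c i len by (simp_all only: le_add_diff_inverse) simp
    then have "(v, u, w) \<in> set (drop 2 cycle_words)" using nth_mem by metis
    then have "rigid (walk base v)" using rigid_cycle_words(1) by (auto simp: list_all_iff)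
    then have "bipartition 4 g (length (walk base (fst (cycle_words ! i))))"
      using nth[OF i(2)] rigid_moved g(2) c by simp
    moreover have "i \<in> {2, 3, 4, 5, 6, 7, 8, 9, 10}" using i by auto
    then have "[3, 3, 4, 5, 6, 7, 8, 9, 10, 11, 12] ! i = i + 2" by auto
    then have "[3, 3, 4, 5, 6, 7, 8, 9, 10, 11, 12] ! i = l" using False l by (simp add: i_def)
    ultimately show ?thesis using length[OF i(2)] by simp
  qed
qed

lemma deletable_4: "deletable 4"
  unfolding deletable_def
proof (intro conjI)
  have eqs: "start1 = perm_of (3, 4, 1, 2)" "swap12 start1 = perm_of (4, 3, 1, 2)"
    "start2 = perm_of (4, 1, 3, 2)" "swap12 start2 = perm_of (1, 4, 3, 2)"
    "rot3 = perm_of (2, 3, 1, 4)" "id = perm_of base" "swap12 id = perm_of (2, 1, 3, 4)"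
    by (auto simp: start1_def start2_def swap12_def rot3_def perm_of.simps base_def fun_eq_iff)
  have rot3: "rot3 \<in> perms 4" and swap: "swap12 id \<in> perms 4"
    using rot3_in_perms swap12_in_perms[OF id_in_perms] by simp_all
  have in4: "perm_of base \<in> perms 4" "perm_of (2, 3, 1, 4) \<in> perms 4" "perm_of (2, 1, 3, 4) \<in> perms 4"
    using id_in_perms[of 4, unfolded eqs(6)] rot3[unfolded eqs(5)] swap[unfolded eqs(7)] by -
  \<comment> \<open>The words \<open>[1, 3]\<close> and \<open>[4]\<close> lead from the identity to
    \<open>start1\<close> and \<open>start2\<close>. The third walk may start at any vertex from
    which it closes up.\<close>
  let ?w1 = "[1, 1, 0, 1, 4, 4, 0, 2, 0, 1, 0, 3, 0, 1, 0, 4, 1, 1, 0, 1, 1, 3]"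
  have 1: "distinct (walk (target [1, 3]) ?w1 @ [base])" "length (walk (target [1, 3]) ?w1 @ [base]) = 24"
    "target [1, 3] = (3, 4, 1, 2)" "last (walk (target [1, 3]) ?w1) = (4, 3, 1, 2)"
    by code_simp+
  have "hp 4 (perms 4 - perm_of ` set [base]) (perm_of (target [1, 3])) (perm_of (last (walk (target [1, 3]) ?w1)))"
    by (rule hp_walk_complement[OF 1(1,2)]) (use in4 in simp)
  \<comment> \<open>Larger terms are rewritten first: \<open>swap12 start1\<close> contains
    \<open>start1\<close>, and the term for the last vertex contains the one for the start.\<close>
  then show "hp 4 (perms 4 - {id}) start1 (swap12 start1)"
    unfolding 1(4) unfolding 1(3) eqs(2) unfolding eqs(1,6) by (simp only: list.set image_insert image_empty)
  let ?w2 = "[2, 2, 0, 2, 3, 1, 1, 0, 3, 1, 0, 1, 1, 0, 4, 0, 1, 0, 2, 0, 4]"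
  have 2: "distinct (walk (target [4]) ?w2 @ [base, (2, 3, 1, 4)])" "length (walk (target [4]) ?w2 @ [base, (2, 3, 1, 4)]) = 24"
    "target [4] = (4, 1, 3, 2)" "last (walk (target [4]) ?w2) = (1, 4, 3, 2)"
    by code_simp+
  have "hp 4 (perms 4 - perm_of ` set [base, (2, 3, 1, 4)]) (perm_of (target [4])) (perm_of (last (walk (target [4]) ?w2)))"
    by (rule hp_walk_complement[OF 2(1,2)]) (use in4 in simp)
  then show "hp 4 (perms 4 - {id, rot3}) start2 (swap12 start2)"
    unfolding 2(4) unfolding 2(3) eqs(4) unfolding eqs(3,5,6) by (simp only: list.set image_insert image_empty)
  let ?w3 = "[1, 1, 3, 1, 0, 1, 3, 1, 4, 0, 1, 1, 0, 4, 0, 1, 1, 0, 1, 4, 4]"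
  have 3: "distinct (walk (target [0, 1, 4, 1]) ?w3 @ [base, (2, 1, 3, 4)])"
    "length (walk (target [0, 1, 4, 1]) ?w3 @ [base, (2, 1, 3, 4)]) = 24" "closes (walk (target [0, 1, 4, 1]) ?w3)"
    by code_simp+
  have p: "hp 4 (perms 4 - {id, swap12 id}) (perm_of (target [0, 1, 4, 1])) (perm_of (last (walk (target [0, 1, 4, 1]) ?w3)))"
    using hp_walk_complement[OF 3(1,2)] in4 unfolding eqs(7) unfolding eqs(6) by simp
  have "card (perms 4 - {id, swap12 id}) \<ge> fact 4 - card {id, swap12 id}"
    using diff_card_le_card_Diff[of "{id, swap12 id}" "perms 4"] by (simp add: card_perms)
  moreover have "card {id, swap12 id} \<le> 2" by (simp add: card_insert_if)
  moreover have "fact 4 = (24::nat)" by (simp add: fact_numeral)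
  ultimately have "3 \<le> card (perms 4 - {id, swap12 id})" by linarith
  then show "hc 4 (perms 4 - {id, swap12 id})"
    using p adj_closes[OF target_in_perms 3(3)] unfolding ham_cycle_def by blast
qed

lemma splittable_all:
  assumes "4 \<le> n"
  shows "ham_connected n \<and> deletable n \<and> splittable n"
  using assms
proof (induction n rule: dec_induct)
  case base
  have "fact 4 div 2 = (12::nat)" by (simp add: fact_numeral)
  then have "splittable 4" using bipartition_4 by (intro splittable_intro deletable_4) auto
  then show ?case using ham_connected_4 deletable_4 by blast
next
  case (step m)
  then interpret split_star_step "Suc m" m by unfold_locales auto
  show ?case using ham_connected_Suc deletable_Suc splittable_Suc step.IH by blast
qed

theorem theorem3p3:
  fixes n :: nat
  assumes "n \<ge> 4"
  shows "two_dcc_vertex_pancyclic (split_star n) 3 (fact n div 2)"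
  using two_dcc_of_splittable splittable_all assms by blast

end
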